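(* Let $g\colon\mathbb{R}^d\to\mathbb{R}$ satisfy Assumptions (A1) and (A2) (with constants $L_1$ and $\alpha,\beta,L_2$), and let $G\colon\mathbb{R}^d\to\mathbb{R}^d$ be a (Borel measurable) $(a,b)$-inexact gradient oracle for $g$. Fix $x_0\in\mathbb{R}^d$, $\Delta_g\ge g(x_0)-\inf g$, and $\delta\in(0,1)$, $\varepsilon_1\in(0,\alpha)$, $\varepsilon_2\in(0,\min\{4\gamma\beta L_2,\,L_1,\,L_1^2\})$. Suppose $$a\le \min\Big\{\tfrac{1}{20},\ \tfrac{1}{L_1\eta M 2^{\gamma+2}},\ \tfrac{R}{\varepsilon_1\eta M 2^{\gamma+2}}\Big\},\qquad b\le\min\Big\{\tfrac{\varepsilon_1}{64},\ \big(\tfrac{F}{40\eta M}\big)^{1/2},\ \big(\tfrac{L_1F}{M(5L_1+1)}\big)^{1/2},\ \tfrac{R}{M\eta 2^{\gamma+2}}\Big\},$$ with $\gamma,F,R,\eta,M$ the parameters defined in the context. Let $$T=8\Delta_g\max\Big\{\frac{2M}{F},\ \frac{256}{(1-a)\eta\varepsilon_1^2}\Big\}+4M$$ (rounded up to an integer). Then with probability at least $1-\delta$, at least one of the iterates $x_0,x_1,\dots,x_T$ generated by Algorithm PIGD with parameters $(\eta,r,M,\varepsilon_1)$ and oracle $G$ is an $(\varepsilon_1,\varepsilon_2)$-second-order critical point of $g$.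
   Context: Assumption (A1): $g\colon\mathbb{R}^d\to\mathbb{R}$ is bounded below and $\|\nabla g(x)-\nabla g(y)\|\le L_1\|x-y\|$ for all $x,y$. Assumption (A2): there are constants $\alpha,\beta,L_2>0$ such that for every $\bar x$ with $\|\nabla g(\bar x)\|\le\alpha$, $g$ is $C^2$ on the closed ball $\mathbb{B}_\beta(\bar x)$ and $\|\nabla^2g(x)-\nabla^2 g(y)\|\le L_2\|x-y\|$ for all $x,y\in\mathbb{B}_\beta(\bar x)$. A map $G\colon\mathbb{R}^d\to\mathbb{R}^d$ is an $(a,b)$-inexact gradient oracle for $g$ if $\|\nabla g(x)-G(x)\|\le a\|\nabla g(x)\|+b$ for all $x$. A point $x$ is an $(\varepsilon_1,\varepsilon_2)$-second-order critical point of $g$ if $\|\nabla g(x)\|\le\varepsilon_1$ and $\lambda_{\min}(\nabla^2 g(x))\ge-\varepsilon_2$. Parameters: $\phi:=2^{24}\max\{1,5\frac{L_2\varepsilon_1}{L_1\varepsilon_2}\}\frac{L_1^2}{\delta}\sqrt d\big(\Delta_g\max\{\frac{L_2^2}{\varepsilon_2^5},\frac{1}{\varepsilon_1^2\varepsilon_2}\}+\frac{1}{\varepsilon_2^2}\big)$, $\gamma:=\log_2(\phi(\log_2\phi)^8)$, $F:=\frac{1}{800\gamma^3}\frac{1-a}{(1+a)^2}\frac{\varepsilon_2^3}{L_2^2}$, $R:=\frac{1}{4\gamma}\frac{\varepsilon_2}{L_2}$, $\eta:=\frac{1-a}{(1+a)^2}\frac{1}{L_1}$, $r:=\frac{\varepsilon_2^2}{400L_2\gamma^3}\min\{1,\frac{L_1\varepsilon_2}{5\varepsilon_1L_2}\}$,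 $M:=\frac{(1+a)^2}{1-a}\frac{L_1}{\varepsilon_2}\gamma$. Algorithm PIGD: set $t_{\rm pert}=-M$. For $t=0,1,\dots,T$: set $u_t=0$; if $\|G(x_t)\|\le\varepsilon_1/2$ and $t-t_{\rm pert}\ge M$, set $t_{\rm pert}=t$ and draw $u_t$ uniformly from the ball $r\mathbb{B}=\{u:\|u\|\le r\}$, independently of everything else; then set $x_{t+1}=x_t-\eta(G(x_t)+u_t)$. *)

theory Defs
  imports "HOL-Probability.Probability"
begin

definition grad :: "(real^'n \<Rightarrow> real) \<Rightarrow> real^'n \<Rightarrow> real^'n" where
  "grad g x = (\<chi> i. frechet_derivative g (at x) (axis i 1))"

definition hess :: "(real^'n \<Rightarrow> real) \<Rightarrow> real^'n \<Rightarrow> real^'n^'n" where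
  "hess g x = matrix (frechet_derivative (grad g) (at x))"

definition opnorm :: "real^'n^'n \<Rightarrow> real" where
  "opnorm H = onorm (\<lambda>v. H *v v)"

definition eigenvalues :: "real^'n^'n \<Rightarrow> real set" where
  "eigenvalues H = {lam. \<exists>v. v \<noteq> 0 \<and> H *v v = lam *\<^sub>R v}"

definition lambda_min :: "real^'n^'n \<Rightarrow> real" where
  "lambda_min H = Inf (eigenvalues H)"

definition assumption_A1 :: "(real^'n \<Rightarrow> real) \<Rightarrow> real \<Rightarrow> bool" where
  "assumption_A1 g L1 \<longleftrightarrow> bdd_below (range g) \<and> (\<forall>x. g differentiable (at x)) \<and>
     (\<forall>x y. norm (grad g x - grad g y) \<le> L1 * norm (x - y))"

definition assumption_A2 :: "(real^'n \<Rightarrow> real) \<Rightarrow> real \<Rightarrow> real \<Rightarrow> real \<Rightarrow> bool" where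
  "assumption_A2 g \<alpha> \<beta> L2 \<longleftrightarrow> (\<forall>xb. norm (grad g xb) \<le> \<alpha> \<longrightarrow>
     (\<forall>x\<in>cball xb \<beta>. grad g differentiable (at x)) \<and>
     continuous_on (cball xb \<beta>) (hess g) \<and>
     (\<forall>x\<in>cball xb \<beta>. \<forall>y\<in>cball xb \<beta>. opnorm (hess g x - hess g y) \<le> L2 * norm (x - y)))"

definition inexact_oracle :: "(real^'n \<Rightarrow> real) \<Rightarrow> (real^'n \<Rightarrow> real^'n) \<Rightarrow> real \<Rightarrow> real \<Rightarrow> bool" where
  "inexact_oracle g G a b \<longleftrightarrow> (\<forall>x. norm (grad g x - G x) \<le> a * norm (grad g x) + b)"

definition second_order_critical :: "(real^'n \<Rightarrow> real) \<Rightarrow> real \<Rightarrow> real \<Rightarrow> real^'n \<Rightarrow> bool" where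
  "second_order_critical g e1 e2 x \<longleftrightarrow> norm (grad g x) \<le> e1 \<and> lambda_min (hess g x) \<ge> - e2"

(* Algorithm PIGD. The random perturbations are realised by an i.i.d. sequence xi of
   uniform samples from the ball r*B; at step t the sample xi t is used iff a perturbation
   is triggered (this gives exactly the law of "draw u_t uniformly, independently").
   State = (x_t, t_pert) before step t is executed. *)
fun pigd_state :: "(real^'n \<Rightarrow> real^'n) \<Rightarrow> real \<Rightarrow> real \<Rightarrow> real \<Rightarrow> real^'n
                   \<Rightarrow> (nat \<Rightarrow> real^'n) \<Rightarrow> nat \<Rightarrow> (real^'n) \<times> real" where
  "pigd_state G \<eta> M e1 x0 xi 0 = (x0, - M)"
| "pigd_state G \<eta> M e1 x0 xi (Suc t) =
     (let (x, tp) = pigd_state G \<eta> M e1 x0 xi t;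
          pert = (norm (G x) \<le> e1 / 2 \<and> real t - tp \<ge> M);
          u = (if pert then xi t else 0);
          tp' = (if pert then real t else tp)
      in (x - \<eta> *\<^sub>R (G x + u), tp'))"

definition pigd_iter :: "(real^'n \<Rightarrow> real^'n) \<Rightarrow> real \<Rightarrow> real \<Rightarrow> real \<Rightarrow> real^'n
                   \<Rightarrow> (nat \<Rightarrow> real^'n) \<Rightarrow> nat \<Rightarrow> real^'n" where
  "pigd_iter G \<eta> M e1 x0 xi t = fst (pigd_state G \<eta> M e1 x0 xi t)"

definition noise_space :: "real \<Rightarrow> (nat \<Rightarrow> real^'n) measure" where
  "noise_space r = PiM UNIV (\<lambda>_. uniform_measure lborel (cball 0 r))"

end

theory Submission
  imports Defs
begin

text \<open>Outside the perturbation windows a step with \<open>\<parallel>G x\<parallel> > \<epsilon>\<^sub>1 / 2\<close> decreases \<open>g\<close> by a fixed amount.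
  If \<open>x\<close> is perturbed and \<open>\<lambda>\<^sub>m\<^sub>i\<^sub>n < - \<epsilon>\<^sub>2\<close>, an orbit that fails to decrease \<open>g\<close> by \<open>F\<close> within \<open>M\<close>
  steps stays in the ball of radius \<open>R / 2\<close> around \<open>x\<close>, because the squared step lengths are
  controlled by the decrease of \<open>g\<close>. In that ball the difference of two orbits follows the power
  iteration of \<open>I - \<eta> \<nabla>\<^sup>2g x\<close> up to small errors, so two perturbations that differ by at least
  \<open>5 R / (\<eta> 2\<^sup>\<gamma>)\<close> along the lowest eigenvector cannot both fail. The set of failing perturbations is
  therefore thin in that direction and occupies a small fraction of the ball. A union
  bound over all \<open>t \<le> T\<close> costs less than \<open>\<delta>\<close>; if no perturbation fails and no critical point is
  met, \<open>g\<close> would drop below its infimum before time \<open>T\<close>.\<close>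

section \<open>Calculus and linear algebra\<close>

lemma has_derivative_grad:
  fixes g :: "real^'n \<Rightarrow> real"
  assumes "g differentiable (at x)"
  shows "(g has_derivative (\<lambda>h. grad g x \<bullet> h)) (at x)"
proof -
  let ?D = "frechet_derivative g (at x)"
  have D: "(g has_derivative ?D) (at x)"
    using assms frechet_derivative_works by blast
  then have lin: "linear ?D" by (rule has_derivative_linear)
  have "?D = (\<lambda>h. grad g x \<bullet> h)"
  proof
    fix h :: "real^'n"
    have "?D h = ?D (\<Sum>i\<in>UNIV. h $ i *\<^sub>R axis i 1)"
      using basis_expansion[of h] by (simp add: scalar_mult_eq_scaleR)
    also have "\<dots> = (\<Sum>i\<in>UNIV. h $ i * ?D (axis i 1))"
      by (simp add: linear_sum[OF lin] linear_scale[OF lin])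
    also have "\<dots> = grad g x \<bullet> h"
      by (simp add: grad_def inner_vec_def mult.commute)
    finally show "?D h = grad g x \<bullet> h" .
  qed
  with D show ?thesis by simp
qed

lemma has_derivative_hess:
  fixes g :: "real^'n \<Rightarrow> real"
  assumes "grad g differentiable (at x)"
  shows "(grad g has_derivative (\<lambda>h. hess g x *v h)) (at x)"
proof -
  let ?D = "frechet_derivative (grad g) (at x)"
  have D: "(grad g has_derivative ?D) (at x)"
    using assms frechet_derivative_works by blast
  then have "linear ?D" by (rule has_derivative_linear)
  then have "(\<lambda>h. hess g x *v h) = ?D"
    by (simp add: hess_def matrix_works fun_eq_iff)
  with D show ?thesis by simp
qed

lemma has_real_derivative_along_line:
  fixes g :: "real^'n \<Rightarrow> real"
  assumes "\<And>x. g differentiable (at x)"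
  shows "((\<lambda>t. g (x + t *\<^sub>R h)) has_real_derivative grad g (x + t *\<^sub>R h) \<bullet> h) (at t)"
proof -
  have "((\<lambda>t. g (x + t *\<^sub>R h)) has_derivative (\<lambda>s. grad g (x + t *\<^sub>R h) \<bullet> (s *\<^sub>R h))) (at t)"
    by (rule has_derivative_compose[OF _ has_derivative_grad[OF assms], where f = "\<lambda>t. x + t *\<^sub>R h"])
       (auto intro!: derivative_eq_intros)
  then show ?thesis
    by (simp add: has_field_derivative_def mult.commute[of _ "grad g (x + t *\<^sub>R h) \<bullet> h"])
qed

lemma descent_inequality:
  fixes g :: "real^'n \<Rightarrow> real"
  assumes diff: "\<And>x. g differentiable (at x)"
    and lip: "\<And>x y. norm (grad g x - grad g y) \<le> L * norm (x - y)"
  shows "g (x + h) \<le> g x + grad g x \<bullet> h + L / 2 * (norm h)\<^sup>2"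
proof -
  let ?f = "\<lambda>t. g (x + t *\<^sub>R h) - t * (grad g x \<bullet> h) - L / 2 * t\<^sup>2 * (norm h)\<^sup>2"
  have "?f 1 \<le> ?f 0"
  proof (rule DERIV_nonpos_imp_nonincreasing[of 0 1 ?f])
    fix t :: real assume t: "0 \<le> t" "t \<le> 1"
    let ?d = "grad g (x + t *\<^sub>R h) \<bullet> h - grad g x \<bullet> h - L * t * (norm h)\<^sup>2"
    have "(?f has_real_derivative ?d) (at t)"
      by (auto intro!: derivative_eq_intros has_real_derivative_along_line[OF diff])
    moreover have "?d \<le> 0"
    proof -
      have "grad g (x + t *\<^sub>R h) \<bullet> h - grad g x \<bullet> h
          \<le> norm (grad g (x + t *\<^sub>R h) - grad g x) * norm h"
        by (metis inner_diff_left norm_cauchy_schwarz)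
      also have "\<dots> \<le> L * norm (t *\<^sub>R h) * norm h"
        using lip[of "x + t *\<^sub>R h" x] by (intro mult_right_mono) auto
      finally show ?thesis
        using t by (simp add: power2_eq_square mult_ac)
    qed
    ultimately show "\<exists>y. (?f has_real_derivative y) (at t) \<and> y \<le> 0" by blast
  qed simp
  then show ?thesis by simp
qed

text \<open>The second difference
  \<open>g (x + s u + s v) - g (x + s u) - g (x + s v) + g x\<close> is symmetric in \<open>u\<close> and \<open>v\<close>, and
  by the mean value theorem it equals \<open>s\<^sup>2 (H v \<bullet> u) + o(s\<^sup>2)\<close>.\<close>

lemma second_difference_approx:
  fixes g :: "real^'n \<Rightarrow> real"
  assumes diff: "\<And>x. g differentiable (at x)"
    and approx: "\<And>w. norm w < \<rho> \<Longrightarrow> norm (grad g (x + w) - grad g x - H *v w) \<le> e * norm w"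
    and s: "0 < s" "s * (norm u + norm v) < \<rho>" and e: "0 \<le> e"
  shows "\<bar>g (x + s *\<^sub>R u + s *\<^sub>R v) - g (x + s *\<^sub>R u) - g (x + s *\<^sub>R v) + g x
           - s\<^sup>2 * ((H *v v) \<bullet> u)\<bar> \<le> s\<^sup>2 * (e * (2 * norm u + norm v) * norm u)"
proof -
  \<comment> \<open>\<open>?f 1 - ?f 0\<close> is the second difference. The mean value theorem in
    the direction \<open>u\<close> turns it into a difference of two gradients, taken at points
    \<open>x + w1\<close> and \<open>x + w2\<close> that differ by
    \<open>s *\<^sub>R v\<close>.\<close>
  let ?f = "\<lambda>t. g ((x + s *\<^sub>R v) + t *\<^sub>R (s *\<^sub>R u)) - g (x + t *\<^sub>R (s *\<^sub>R u))"
  let ?d = "\<lambda>t. grad g ((x + s *\<^sub>R v) + t *\<^sub>R (s *\<^sub>R u)) \<bullet> (s *\<^sub>R u)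
                 - grad g (x + t *\<^sub>R (s *\<^sub>R u)) \<bullet> (s *\<^sub>R u)"
  have "(?f has_real_derivative ?d t) (at t)" for t
    by (intro DERIV_diff has_real_derivative_along_line[OF diff])
  then obtain t where t: "0 < t" "t < 1" "?f 1 - ?f 0 = (1 - 0) * ?d t"
    using MVT2[of 0 1 ?f ?d] by auto
  define w1 where "w1 = s *\<^sub>R v + (t * s) *\<^sub>R u"
  define w2 where "w2 = (t * s) *\<^sub>R u"
  define q1 where "q1 = grad g (x + w1) - grad g x - H *v w1"
  define q2 where "q2 = grad g (x + w2) - grad g x - H *v w2"
  have ts: "t * s \<le> s" "0 \<le> t * s" using t s by (auto simp: mult_le_cancel_right2)
  have n2: "norm w2 \<le> s * norm u"
    unfolding w2_def using ts by (simp add: mult_right_mono)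
  have n1: "norm w1 \<le> s * norm v + s * norm u"
    unfolding w1_def using ts s
    by (intro norm_triangle_le) (simp add: mult_right_mono)
  have b1: "norm q1 \<le> e * (s * norm v + s * norm u)"
    unfolding q1_def using n1 s e approx[of w1]
    by (smt (verit, best) distrib_left mult_left_mono)
  have b2: "norm q2 \<le> e * (s * norm u)"
    unfolding q2_def using n2 n1 s e approx[of w2]
    by (smt (verit, best) distrib_left mult_left_mono mult_nonneg_nonneg norm_ge_zero)
  have "H *v w1 - H *v w2 = s *\<^sub>R (H *v v)"
    unfolding w1_def w2_def
    by (simp add: matrix_vector_right_distrib matrix_vector_mult_scaleR)
  then have "grad g (x + w1) - grad g (x + w2) = s *\<^sub>R (H *v v) + (q1 - q2)"
    unfolding q1_def q2_def by (simp add: algebra_simps)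
  then have "?d t = (s *\<^sub>R (H *v v) + (q1 - q2)) \<bullet> (s *\<^sub>R u)"
    unfolding w1_def w2_def
    by (simp only: add.assoc scaleR_scaleR flip: inner_diff_left)
  then have "?d t = s\<^sup>2 * ((H *v v) \<bullet> u) + s * ((q1 - q2) \<bullet> u)"
    by (simp add: inner_add_left power2_eq_square algebra_simps)
  then have "\<bar>?f 1 - ?f 0 - s\<^sup>2 * ((H *v v) \<bullet> u)\<bar> = s * \<bar>(q1 - q2) \<bullet> u\<bar>"
    using t s by (simp add: abs_mult)
  also have "\<dots> \<le> s * ((norm q1 + norm q2) * norm u)"
    using s by (intro mult_left_mono order_trans[OF Cauchy_Schwarz_ineq2] mult_right_mono
        norm_triangle_ineq4) auto
  also have "\<dots> \<le> s * ((e * (s * norm v + s * norm u) + e * (s * norm u)) * norm u)"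
    using b1 b2 s by (intro mult_left_mono mult_right_mono add_mono) auto
  also have "\<dots> = s\<^sup>2 * (e * (2 * norm u + norm v) * norm u)"
    by (simp add: algebra_simps power2_eq_square)
  finally show ?thesis by (simp add: algebra_simps)
qed

text \<open>Both \<open>s\<^sup>2 * ((H *v v) \<bullet> u)\<close> and the same term with
  \<open>u\<close> and \<open>v\<close> exchanged approximate one second difference, up to
  \<open>s\<^sup>2\<close> times an arbitrarily small number. Differentiability of the gradient at
  the single point \<open>x\<close> suffices for this.\<close>

lemma hess_symmetric:
  fixes g :: "real^'n \<Rightarrow> real"
  assumes diff: "\<And>x. g differentiable (at x)" and twice: "grad g differentiable (at x)"
  shows "(hess g x *v u) \<bullet> v = u \<bullet> (hess g x *v v)"
proof -
  define H where "H = hess g x"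
  define C where "C = (2 * norm u + norm v) * norm u + (2 * norm v + norm u) * norm v"
  have "\<bar>(H *v v) \<bullet> u - (H *v u) \<bullet> v\<bar> \<le> 0 + e" if "e > 0" for e
  proof -
    \<comment> \<open>The \<open>+ 1\<close> here and in \<open>s\<close> below keeps the quotients
      defined when \<open>u\<close> and \<open>v\<close> both vanish.\<close>
    define e' where "e' = e / (C + 1)"
    have C: "C \<ge> 0" unfolding C_def by simp
    have e': "e' > 0" "e' * C \<le> e"
      using that C unfolding e'_def by (auto simp: divide_simps mult_left_mono)
    obtain \<rho> where \<rho>: "\<rho> > 0"
      "\<And>y. norm (y - x) < \<rho> \<Longrightarrow> norm (grad g y - grad g x - H *v (y - x)) \<le> e' * norm (y - x)"
      using has_derivative_hess[OF twice] e'(1) unfolding has_derivative_at_alt H_def by metis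
    have approx: "norm (grad g (x + w) - grad g x - H *v w) \<le> e' * norm w" if "norm w < \<rho>" for w
      using \<rho>(2)[of "x + w"] that by simp
    define s where "s = \<rho> / (2 * (norm u + norm v + 1))"
    have np: "norm u + norm v + 1 > 0" by (smt (verit) norm_ge_zero)
    have s: "s > 0" using \<rho> np by (simp add: s_def)
    have "s * (norm u + norm v) < s * (2 * (norm u + norm v + 1))"
      using s by (intro mult_strict_left_mono) (smt (verit) norm_ge_zero)+
    also have "\<dots> = \<rho>" using np by (simp add: s_def)
    finally have s': "s * (norm u + norm v) < \<rho>" .
    note 1 = second_difference_approx[of g \<rho> x H e' s u v, OF diff approx s s']
    note 2 = second_difference_approx[of g \<rho> x H e' s v u, OF diff approx s]
    have "s\<^sup>2 * \<bar>(H *v v) \<bullet> u - (H *v u) \<bullet> v\<bar> = \<bar>s\<^sup>2 * ((H *v v) \<bullet> u) - s\<^sup>2 * ((H *v u) \<bullet> v)\<bar>"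
      by (simp add: abs_mult flip: right_diff_distrib)
    also have "\<dots> \<le> s\<^sup>2 * (e' * (2 * norm u + norm v) * norm u) + s\<^sup>2 * (e' * (2 * norm v + norm u) * norm v)"
      using 1 2 s' e' by (simp add: add_ac)
    also have "\<dots> = s\<^sup>2 * (e' * C)" by (simp add: C_def algebra_simps)
    finally have "\<bar>(H *v v) \<bullet> u - (H *v u) \<bullet> v\<bar> \<le> e' * C" using s by simp
    with e' show ?thesis by simp
  qed
  then have "\<bar>(H *v v) \<bullet> u - (H *v u) \<bullet> v\<bar> \<le> 0" by (rule field_le_epsilon)
  then show ?thesis by (simp add: H_def inner_commute)
qed

text \<open>The gradient increment over a short step along \<open>v\<close> is at most
  \<open>L\<close> times the step length and differs from the Hessian term by an arbitrarily small
  fraction of that length.\<close>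

lemma hess_norm_le:
  fixes g :: "real^'n \<Rightarrow> real"
  assumes twice: "grad g differentiable (at x)"
    and lip: "\<And>x y. norm (grad g x - grad g y) \<le> L * norm (x - y)"
  shows "norm (hess g x *v v) \<le> L * norm v"
proof (cases "v = 0")
  case False
  have "norm (hess g x *v v) \<le> L * norm v + e" if "e > 0" for e
  proof -
    define e' where "e' = e / norm v"
    have e': "e' > 0" "e' * norm v = e" using that False by (auto simp: e'_def)
    obtain \<rho> where \<rho>: "\<rho> > 0"
      "\<And>y. norm (y - x) < \<rho> \<Longrightarrow> norm (grad g y - grad g x - hess g x *v (y - x)) \<le> e' * norm (y - x)"
      using has_derivative_hess[OF twice] e'(1) unfolding has_derivative_at_alt by metis
    define s where "s = \<rho> / (2 * norm v)"
    have s: "s > 0" "norm (s *\<^sub>R v) < \<rho>" using \<rho> False by (auto simp: s_def)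
    have "norm (hess g x *v (s *\<^sub>R v)) \<le> norm (grad g (x + s *\<^sub>R v) - grad g x) +
       norm (grad g (x + s *\<^sub>R v) - grad g x - hess g x *v (s *\<^sub>R v))"
      by (metis norm_triangle_sub norm_minus_commute add.commute)
    also have "\<dots> \<le> L * norm (s *\<^sub>R v) + e' * norm (s *\<^sub>R v)"
      using \<rho>(2)[of "x + s *\<^sub>R v"] s lip[of "x + s *\<^sub>R v" x] by (intro add_mono) auto
    finally have "s * norm (hess g x *v v) \<le> s * (L * norm v + e)"
      using s by (simp add: matrix_vector_mult_scaleR algebra_simps flip: e'(2))
    then show ?thesis using s by simp
  qed
  then show ?thesis by (rule field_le_epsilon)
qed simp

section \<open>Positive semidefinite operators and the least eigenvalue\<close>

text \<open>The form at \<open>u + t *\<^sub>R v\<close> is a nonnegative quadratic in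
  \<open>t\<close>; its value at the minimiser gives the claim. Since \<open>B\<close> may be
  singular, \<open>v \<bullet> B v = 0\<close> is a separate case: the quadratic is then affine and
  must be constant.\<close>

lemma psd_Cauchy_Schwarz:
  fixes B :: "'a::real_inner \<Rightarrow> 'a"
  assumes lin: "linear B" and sym: "\<And>u v. B u \<bullet> v = u \<bullet> B v" and psd: "\<And>v. 0 \<le> v \<bullet> B v"
  shows "(u \<bullet> B v)\<^sup>2 \<le> (u \<bullet> B u) * (v \<bullet> B v)"
proof -
  have "0 \<le> (u \<bullet> B u) + 2 * t * (u \<bullet> B v) + t\<^sup>2 * (v \<bullet> B v)" for t
    using psd[of "u + t *\<^sub>R v"] sym[of u v] sym[of v u]
    by (simp add: linear_add[OF lin] linear_scale[OF lin] inner_simps power2_eq_square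
        algebra_simps inner_commute)
  note q = this
  show ?thesis
  proof (cases "v \<bullet> B v = 0")
    case True
    have "u \<bullet> B v = 0"
    proof (rule ccontr)
      assume nz: "u \<bullet> B v \<noteq> 0"
      \<comment> \<open>At this \<open>t\<close> the affine function would equal -1.\<close>
      with q[of "- ((u \<bullet> B u) + 1) / (2 * (u \<bullet> B v))"] True show False by (simp add: field_simps)
    qed
    with True show ?thesis by simp
  next
    case False
    then have p: "v \<bullet> B v > 0" using psd[of v] by simp
    have "0 \<le> (v \<bullet> B v) * ((u \<bullet> B u) + 2 * (- (u \<bullet> B v) / (v \<bullet> B v)) * (u \<bullet> B v)
        + (- (u \<bullet> B v) / (v \<bullet> B v))\<^sup>2 * (v \<bullet> B v))"
      using p by (intro mult_nonneg_nonneg q) auto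
    also have "\<dots> = (v \<bullet> B v) * (u \<bullet> B u) - (u \<bullet> B v)\<^sup>2"
      using p by (simp add: field_simps power2_eq_square)
    finally show ?thesis by (simp add: mult.commute)
  qed
qed

text \<open>Cauchy-Schwarz for the form of \<open>B\<close>, applied to \<open>B v\<close> and
  \<open>v\<close>, passes from a bound on the quadratic form to a bound on the norm without
  diagonalising \<open>B\<close>.\<close>

lemma psd_norm_le:
  fixes B :: "'a::real_inner \<Rightarrow> 'a"
  assumes lin: "linear B" and sym: "\<And>u v. B u \<bullet> v = u \<bullet> B v" and psd: "\<And>v. 0 \<le> v \<bullet> B v"
    and ub: "\<And>v. v \<bullet> B v \<le> \<mu> * (norm v)\<^sup>2"
  shows "norm (B v) \<le> \<mu> * norm v"
proof (cases "B v = 0")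
  case True
  have "0 \<le> \<mu> * norm v"
  proof (cases "v = 0")
    case False
    have "0 \<le> \<mu> * (norm v)\<^sup>2" using psd[of v] ub[of v] by linarith
    then show ?thesis using False by (simp add: zero_le_mult_iff)
  qed simp
  then show ?thesis using True by simp
next
  case False
  have p: "0 \<le> \<mu> * (norm v)\<^sup>2" using psd[of v] ub[of v] by linarith
  have vn: "v \<noteq> 0" using False linear_0[OF lin] by auto
  have mu: "\<mu> \<ge> 0" using p vn by (simp add: zero_le_mult_iff)
  have "(B v \<bullet> B v)\<^sup>2 \<le> (B v \<bullet> B (B v)) * (v \<bullet> B v)"
    by (rule psd_Cauchy_Schwarz[OF lin sym psd])
  also have "\<dots> \<le> (\<mu> * (norm (B v))\<^sup>2) * (\<mu> * (norm v)\<^sup>2)"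
    using psd ub p mu by (intro mult_mono) auto
  finally have "(norm (B v))\<^sup>2 * (norm (B v))\<^sup>2 \<le> (norm (B v))\<^sup>2 * (\<mu> * norm v)\<^sup>2"
    by (simp add: power_mult_distrib power2_eq_square algebra_simps flip: power2_norm_eq_inner)
  then have "(norm (B v))\<^sup>2 \<le> (\<mu> * norm v)\<^sup>2" using False
    by (subst (asm) mult_le_cancel_left_pos) simp_all
  then show ?thesis by (rule power2_le_imp_le) (use mu in simp)
qed

text \<open>A minimiser \<open>e\<close> of the quadratic form on the unit sphere exists by
  compactness. With \<open>\<mu>\<close> the minimum, \<open>H - \<mu> I\<close> is positive
  semidefinite and its form vanishes at \<open>e\<close>, so Cauchy-Schwarz forces \<open>e\<close>
  into its kernel. In particular the infimum in \<open>lambda_min\<close> is attained.\<close>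

lemma lambda_min_symmetric:
  fixes H :: "real^'n^'n"
  assumes sym: "\<And>u v. (H *v u) \<bullet> v = u \<bullet> (H *v v)"
  obtains e where "norm e = 1" "H *v e = lambda_min H *\<^sub>R e"
    "\<And>v. lambda_min H * (norm v)\<^sup>2 \<le> v \<bullet> (H *v v)"
proof -
  have "\<exists>e\<in>sphere 0 1. \<forall>v\<in>sphere 0 1. e \<bullet> (H *v e) \<le> v \<bullet> (H *v v)"
  proof (rule continuous_attains_inf)
    show "sphere (0 :: real^'n) 1 \<noteq> {}" by (simp)
    show "continuous_on (sphere 0 1) (\<lambda>v. v \<bullet> (H *v v))"
      by (intro continuous_intros matrix_vector_mult_linear_continuous_on)
  qed simp
  then obtain e where e: "norm e = 1" "\<And>v. norm v = 1 \<Longrightarrow> e \<bullet> (H *v e) \<le> v \<bullet> (H *v v)" by auto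
  define \<mu> where "\<mu> = e \<bullet> (H *v e)"
  have low: "\<mu> * (norm v)\<^sup>2 \<le> v \<bullet> (H *v v)" for v
  proof (cases "v = 0")
    case False
    define w where "w = v /\<^sub>R norm v"
    have v: "v = norm v *\<^sub>R w" "norm w = 1" using False by (auto simp: w_def)
    have "\<mu> * (norm v)\<^sup>2 \<le> (w \<bullet> (H *v w)) * (norm v)\<^sup>2"
      using e(2)[OF v(2)] by (intro mult_right_mono) (auto simp: \<mu>_def)
    also have "\<dots> = v \<bullet> (H *v v)"
      by (subst (2 3) v(1)) (simp add: matrix_vector_mult_scaleR power2_eq_square)
    finally show ?thesis .
  qed simp
  define B where "B v = H *v v - \<mu> *\<^sub>R v" for v
  have lin: "linear B" unfolding B_def
    by (intro linear_compose_sub matrix_vector_mul_linear linear_compose_scale_right linear_id[unfolded id_def])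
  have B_sym: "B u \<bullet> v = u \<bullet> B v" for u v by (simp add: B_def inner_simps sym)
  have psd: "0 \<le> v \<bullet> B v" for v
    using low[of v] by (simp add: B_def inner_simps power2_norm_eq_inner)
  have "(B e \<bullet> B e)\<^sup>2 \<le> (B e \<bullet> B (B e)) * (e \<bullet> B e)"
    by (rule psd_Cauchy_Schwarz[OF lin B_sym psd])
  also have "e \<bullet> B e = 0"
    using e(1) by (simp add: B_def inner_simps \<mu>_def flip: power2_norm_eq_inner)
  finally have He: "H *v e = \<mu> *\<^sub>R e" by (simp add: B_def)
  have "lambda_min H = \<mu>"
    unfolding lambda_min_def
  proof (rule cInf_eq_minimum)
    show "\<mu> \<in> eigenvalues H" using He e(1) by (auto simp: eigenvalues_def intro!: exI[of _ e])
    fix l assume "l \<in> eigenvalues H"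
    then obtain v where v: "v \<noteq> 0" "H *v v = l *\<^sub>R v" by (auto simp: eigenvalues_def)
    have "\<mu> * (norm v)\<^sup>2 \<le> l * (norm v)\<^sup>2" using low[of v] v by (simp add: power2_norm_eq_inner)
    with v show "\<mu> \<le> l" by simp
  qed
  with that[OF e(1)] He low show ?thesis by simp
qed

text \<open>Replaces the eigenvalue bound by inequalities that are linear in the entries of
  \<open>H\<close>, which is how the closedness of the critical set is obtained.\<close>

lemma lambda_min_ge_iff:
  fixes H :: "real^'n^'n"
  assumes sym: "\<And>u v. (H *v u) \<bullet> v = u \<bullet> (H *v v)"
  shows "c \<le> lambda_min H \<longleftrightarrow> (\<forall>v. c * (norm v)\<^sup>2 \<le> v \<bullet> (H *v v))"
proof -
  obtain e where e: "norm e = 1" "H *v e = lambda_min H *\<^sub>R e"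
    "\<And>v. lambda_min H * (norm v)\<^sup>2 \<le> v \<bullet> (H *v v)"
    using lambda_min_symmetric[OF sym] by blast
  show ?thesis
  proof
    assume "c \<le> lambda_min H"
    then show "\<forall>v. c * (norm v)\<^sup>2 \<le> v \<bullet> (H *v v)"
      using e(3) by (meson mult_right_mono order_trans zero_le_power2)
  next
    assume "\<forall>v. c * (norm v)\<^sup>2 \<le> v \<bullet> (H *v v)"
    then have "c * (norm e)\<^sup>2 \<le> e \<bullet> (H *v e)" by blast
    then show "c \<le> lambda_min H" using e(1,2) by (simp flip: power2_norm_eq_inner)
  qed
qed

section \<open>Volume of sets that are thin in one direction\<close>

text \<open>Translating the part of \<open>S\<close> with \<open>e \<bullet> u \<le> 0\<close> along \<open>e\<close> and the rest along \<open>- e\<close> does not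
  produce a positive cross term in the norm, so about \<open>r / (r\<^sub>0 \<surd>d)\<close> disjoint copies of \<open>S\<close> fit
  into the ball of radius \<open>\<surd>(r\<^sup>2 + r\<^sup>2 / d)\<close>, whose volume is at most \<open>\<surd>e\<close> times that of
  the ball of radius \<open>r\<close>.\<close>

lemma measure_thin_set_le:
  fixes S :: "'a::euclidean_space set"
  assumes S: "S \<in> lmeasurable" "S \<subseteq> cball 0 r" and r: "r > 0" and r0: "r0 > 0"
    and e: "norm e = 1"
    and thin: "\<And>u s. u \<in> S \<Longrightarrow> s \<ge> r0 \<Longrightarrow> u + s *\<^sub>R e \<notin> S"
  shows "measure lebesgue S
           \<le> 5 / 3 * sqrt (real DIM('a)) * r0 / r * measure lebesgue (cball 0 r :: 'a set)"
proof -
  define d where "d = DIM('a)"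
  have d: "d > 0" by (simp add: d_def)
  \<comment> \<open>The largest shift allowed: it adds only \<open>r\<^sup>2 / d\<close> to the
    squared radius, so the volume of the enlarged ball stays bounded by a factor independent of the
    dimension.\<close>
  define h where "h = r / sqrt (real d)"
  have h: "h > 0" "h\<^sup>2 = r\<^sup>2 / real d" using r d by (auto simp: h_def power_divide)
  \<comment> \<open>Rounding down and adding 1 gives at least \<open>h / r0\<close> copies, while
    every shift \<open>k * r0\<close> with \<open>k < N\<close> is still at most
    \<open>h\<close>.\<close>
  define N where "N = nat \<lfloor>h / r0\<rfloor> + 1"
  have N: "h / r0 \<le> real N" and kh: "real k * r0 \<le> h" if "k < N" for k
  proof -
    show "h / r0 \<le> real N" unfolding N_def by linarith
    have "real k \<le> h / r0" using that h r0 unfolding N_def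
      by (smt (verit) Suc_eq_plus1 divide_nonneg_nonneg le_floor_iff less_Suc_eq_le nat_le_iff of_int_of_nat_eq of_nat_le_iff of_nat_nat zero_le_floor)
    then show "real k * r0 \<le> h" using r0 by (simp add: field_simps)
  qed
  define S1 where "S1 = S \<inter> {u. e \<bullet> u \<le> 0}"
  define S2 where "S2 = S \<inter> {u. e \<bullet> u > 0}"
  have half: "{u. e \<bullet> u \<le> 0} \<in> sets lebesgue" "{u. e \<bullet> u > 0} \<in> sets lebesgue"
    by (auto intro!: lebesgue_closedin lebesgue_openin simp: closed_halfspace_le open_halfspace_gt)
  have m1: "S1 \<in> lmeasurable" and m2: "S2 \<in> lmeasurable"
    unfolding S1_def S2_def using S(1) half by (auto intro: fmeasurable_Int_fmeasurable)
  have S12: "S1 \<union> S2 = S" "S1 \<inter> S2 = {}" unfolding S1_def S2_def by auto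
  define A where "A k = (+) ((real k * r0) *\<^sub>R e) ` S1" for k
  define B where "B k = (+) (- (real k * r0) *\<^sub>R e) ` S2" for k
  have mA: "A k \<in> lmeasurable" "measure lebesgue (A k) = measure lebesgue S1" for k
    unfolding A_def using m1 by (auto simp: measurable_translation measure_translation)
  have mB: "B k \<in> lmeasurable" "measure lebesgue (B k) = measure lebesgue S2" for k
    unfolding B_def by (rule measurable_translation[OF m2], rule measure_translation)
  have no: "u = v" if "u \<in> S" "v \<in> S" "u + (real i * r0) *\<^sub>R e = v + (real j * r0) *\<^sub>R e" for u v and i j :: nat
  proof (cases i j rule: linorder_cases)
    case less
    have "u = v + (real (j - i) * r0) *\<^sub>R e" using that less
      by (simp add: of_nat_diff algebra_simps)
    moreover have "real (j - i) * r0 \<ge> r0" using less r0 by simp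
    ultimately show ?thesis using thin[OF that(2)] that(1) by blast
  next
    case greater
    have "v = u + (real (i - j) * r0) *\<^sub>R e" using that greater
      by (simp add: of_nat_diff algebra_simps)
    moreover have "real (i - j) * r0 \<ge> r0" using greater r0 by simp
    ultimately show ?thesis using thin[OF that(1)] that(2) by blast
  qed (use that in simp)
  have e0: "e \<noteq> 0" using e by auto
  have djA: "disjoint_family_on A {..<N}"
  proof (clarsimp simp: disjoint_family_on_def)
    fix i j :: nat assume "i \<noteq> j"
    have "i = j" if "u \<in> S1" "v \<in> S1" "(real i * r0) *\<^sub>R e + u = (real j * r0) *\<^sub>R e + v" for u v
      using no[of u v i j] that S12 r0 e0 by (auto simp: add.commute)
    with \<open>i \<noteq> j\<close> show "A i \<inter> A j = {}" unfolding A_def by blast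
  qed
  have djB: "disjoint_family_on B {..<N}"
  proof (clarsimp simp: disjoint_family_on_def)
    fix i j :: nat assume "i \<noteq> j"
    have "i = j" if "u \<in> S2" "v \<in> S2" "- (real i * r0) *\<^sub>R e + u = - (real j * r0) *\<^sub>R e + v" for u v
      using no[of u v j i] that S12 r0 e0 by (auto simp: algebra_simps)
    with \<open>i \<noteq> j\<close> show "B i \<inter> B j = {}" unfolding B_def by blast
  qed
  \<comment> \<open>The two halves move in opposite directions, so a common point would make
    \<open>v\<close> the translate of \<open>u\<close> by \<open>i + j\<close> shifts. Then
    \<open>no\<close> gives \<open>u = v\<close>, although the halves are disjoint.\<close>
  have djAB: "A i \<inter> B j = {}" for i j
  proof -
    have False if "u \<in> S1" "v \<in> S2" "(real i * r0) *\<^sub>R e + u = - (real j * r0) *\<^sub>R e + v" for u v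
    proof -
      have "u + (real (i + j) * r0) *\<^sub>R e = v + (real 0 * r0) *\<^sub>R e"
        using that(3) by (simp add: algebra_simps)
      then have "u = v" using no[of u v "i + j" 0] that S12 by blast
      then show False using that S12 by blast
    qed
    then show ?thesis unfolding A_def B_def by blast
  qed
  let ?\<rho> = "sqrt (r\<^sup>2 + h\<^sup>2)"
  have in_ball: "u + t *\<^sub>R e \<in> cball 0 ?\<rho>" if "u \<in> S" "t * (e \<bullet> u) \<le> 0" "\<bar>t\<bar> \<le> h" for u t
  proof -
    have "(norm (u + t *\<^sub>R e))\<^sup>2 = (norm u)\<^sup>2 + 2 * (t * (e \<bullet> u)) + t\<^sup>2 * (norm e)\<^sup>2"
      unfolding power2_norm_eq_inner
      by (simp add: inner_simps algebra_simps power2_eq_square inner_commute)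
    also have "\<dots> \<le> r\<^sup>2 + 0 + h\<^sup>2 * 1"
      using that S(2) r h(1) e
      by (intro add_mono mult_mono) (auto intro!: power_mono abs_le_square_iff[THEN iffD1])
    finally show ?thesis by (simp add: real_le_rsqrt)
  qed
  have subA: "A k \<subseteq> cball 0 ?\<rho>" if "k < N" for k
  proof -
    have "u + (real k * r0) *\<^sub>R e \<in> cball 0 ?\<rho>" if "u \<in> S1" for u
      by (rule in_ball) (use that kh[OF \<open>k < N\<close>] r0 in \<open>auto simp: S1_def mult_nonneg_nonpos\<close>)
    then show ?thesis unfolding A_def by (auto simp: add.commute)
  qed
  have subB: "B k \<subseteq> cball 0 ?\<rho>" if "k < N" for k
  proof -
    have "u + (- (real k * r0)) *\<^sub>R e \<in> cball 0 ?\<rho>" if "u \<in> S2" for u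
      by (rule in_ball) (use that kh[OF \<open>k < N\<close>] r0 in \<open>auto simp: S2_def mult_nonneg_nonpos\<close>)
    then show ?thesis unfolding B_def by (auto simp: add.commute)
  qed
  have fm: "(\<Union>k<N. A k) \<in> lmeasurable" "(\<Union>k<N. B k) \<in> lmeasurable"
    using mA mB by (auto intro!: fmeasurable.finite_UN)
  have "real N * measure lebesgue S = real N * measure lebesgue S1 + real N * measure lebesgue S2"
    using measure_Un3[OF m1 m2] S12 by (simp add: algebra_simps)
  also have "real N * measure lebesgue S1 = measure lebesgue (\<Union>k<N. A k)"
    by (subst measure_finite_Union)
       (use mA djA in \<open>auto intro: fmeasurableD dest: fmeasurableD2 simp del: emeasure_completion\<close>)
  also have "real N * measure lebesgue S2 = measure lebesgue (\<Union>k<N. B k)"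
    by (subst measure_finite_Union)
       (use mB djB in \<open>auto intro: fmeasurableD dest: fmeasurableD2 simp del: emeasure_completion\<close>)
  also have "measure lebesgue (\<Union>k<N. A k) + measure lebesgue (\<Union>k<N. B k)
      = measure lebesgue ((\<Union>k<N. A k) \<union> (\<Union>k<N. B k))"
    using measure_Un3[OF fm] djAB by (simp add: Int_UN_distrib2)
  also have "\<dots> \<le> measure lebesgue (cball 0 ?\<rho> :: 'a set)"
    using subA subB fm by (intro measure_mono_fmeasurable) (auto intro: fmeasurableD)
  also have "\<dots> = (?\<rho> / r) ^ d * measure lebesgue (cball 0 r :: 'a set)"
    using r by (simp add: content_cball d_def power_divide field_simps measure_completion)
  \<comment> \<open>The square of this ratio is at most e, and 25/9 exceeds e: the source of the
    factor 5/3.\<close>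
  also have "(?\<rho> / r) ^ d \<le> 5 / 3"
  proof -
    have "r\<^sup>2 + h\<^sup>2 = r\<^sup>2 * (1 + 1 / real d)" by (simp add: h(2) algebra_simps)
    then have "?\<rho> / r = sqrt (1 + 1 / real d)"
      using r by (simp only: real_sqrt_mult) simp
    then have "((?\<rho> / r) ^ d)\<^sup>2 = (1 + 1 / real d) ^ d"
      by (simp add: power2_eq_square flip: power_mult_distrib)
    also have "\<dots> \<le> exp (1 / real d) ^ d"
      by (intro power_mono) (auto simp: exp_ge_add_one_self)
    also have "\<dots> = exp 1" using d by (simp flip: exp_of_nat_mult)
    also have "\<dots> \<le> (5 / 3)\<^sup>2" using e_less_272 by (simp add: power2_eq_square)
    finally show ?thesis by (rule power2_le_imp_le) simp
  qed
  finally have "real N * measure lebesgue S \<le> 5 / 3 * measure lebesgue (cball 0 r :: 'a set)"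
    by (simp add: mult_right_mono)
  moreover have "h / r0 * measure lebesgue S \<le> real N * measure lebesgue S"
    by (intro mult_right_mono N[of 0]) (auto simp: N_def)
  ultimately have "h / r0 * measure lebesgue S \<le> 5 / 3 * measure lebesgue (cball 0 r :: 'a set)"
    by linarith
  then show ?thesis
    using r r0 d unfolding h_def d_def[symmetric] by (simp add: field_simps)
qed

section \<open>Power iteration with errors\<close>

text \<open>By induction the deviation from the exact iterate
  \<open>(\<mu> ^ t * c) *\<^sub>R e\<close> is at most \<open>t / (2 * M)\<close> of the length of
  that iterate. Over at most \<open>M\<close> steps this consumes no more than half of the
  growth.\<close>

lemma perturbed_power_iteration_growth:
  fixes B :: "'a::real_normed_vector \<Rightarrow> 'a"
  assumes lin: "linear B" and bnd: "\<And>v. norm (B v) \<le> \<mu> * norm v" and Be: "B e = \<mu> *\<^sub>R e"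
    and e: "norm e = 1" and \<mu>: "\<mu> \<ge> 1" and M: "M > 0"
    and z0: "z 0 = c *\<^sub>R e"
    and step: "\<And>t. t < n \<Longrightarrow> norm (z (Suc t) - B (z t)) \<le> 1 / (8 * M) * norm (z t) + \<bar>c\<bar> / (4 * M)"
    and n: "real n \<le> M"
  shows "\<mu> ^ n * \<bar>c\<bar> / 2 \<le> norm (z n)"
proof -
  define D where "D t = z t - (\<mu> ^ t * c) *\<^sub>R e" for t
  have p: "norm ((\<mu> ^ t * c) *\<^sub>R e) = \<mu> ^ t * \<bar>c\<bar>" for t
    using e \<mu> by (simp add: abs_mult)
  have D: "norm (D t) \<le> real t * (\<mu> ^ t * \<bar>c\<bar>) / (2 * M)" if "t \<le> n" for t
    using that
  proof (induction t)
    case 0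
    then show ?case by (simp add: D_def z0)
  next
    case (Suc t)
    let ?p = "\<mu> ^ t * \<bar>c\<bar>"
    have pc: "0 \<le> ?p" "\<bar>c\<bar> \<le> ?p" using \<mu> by (auto simp: mult_le_cancel_right1)
    have IH: "norm (D t) \<le> real t * ?p / (2 * M)" using Suc by simp
    \<comment> \<open>The induction hypothesis itself keeps \<open>z t\<close> below twice the exact
      iterate, so each of the two error terms costs at most \<open>?p / (4 * M)\<close>.\<close>
    have "real t / (2 * M) \<le> 1" using Suc.prems n M by (simp add: field_simps)
    then have "real t * ?p / (2 * M) \<le> ?p"
      using mult_right_mono[of "real t / (2 * M)" 1 ?p] pc by simp
    then have nz: "norm (z t) \<le> 2 * ?p"
      using IH norm_triangle_ineq[of "D t" "(\<mu> ^ t * c) *\<^sub>R e"] p[of t] by (simp add: D_def)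
    have "D (Suc t) = B (D t) + (z (Suc t) - B (z t))"
      by (simp add: D_def linear_diff[OF lin] linear_scale[OF lin] Be mult.commute)
    then have "norm (D (Suc t)) \<le> \<mu> * norm (D t) + (1 / (8 * M) * norm (z t) + \<bar>c\<bar> / (4 * M))"
      using Suc.prems step[of t] by (simp only:) (intro norm_triangle_le add_mono bnd, simp_all)
    also have "\<dots> \<le> \<mu> * (real t * ?p / (2 * M)) + (1 / (8 * M) * (2 * ?p) + ?p / (4 * M))"
      using IH nz pc \<mu> M by (intro add_mono mult_left_mono divide_right_mono) auto
    also have "\<dots> = \<mu> * (real t * ?p / (2 * M)) + 1 * (?p / (2 * M))"
      using M by (simp add: field_simps)
    also have "\<dots> \<le> \<mu> * (real t * ?p / (2 * M)) + \<mu> * (?p / (2 * M))"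
      using pc \<mu> M by (intro add_mono mult_right_mono) auto
    finally show ?case using M by (simp add: field_simps)
  qed
  have "real n / (2 * M) \<le> 1 / 2" using n M by (simp add: field_simps)
  then have "real n * (\<mu> ^ n * \<bar>c\<bar>) / (2 * M) \<le> \<mu> ^ n * \<bar>c\<bar> / 2"
    using mult_right_mono[of "real n / (2 * M)" "1 / 2" "\<mu> ^ n * \<bar>c\<bar>"] \<mu> by simp
  then have "norm (D n) \<le> \<mu> ^ n * \<bar>c\<bar> / 2" using D[of n] by linarith
  moreover have "\<mu> ^ n * \<bar>c\<bar> \<le> norm (z n) + norm (D n)"
    using norm_triangle_ineq4[of "z n" "D n"] p[of n] by (simp add: D_def)
  ultimately show ?thesis by simp
qed

section \<open>Closedness of the critical set\<close>

text \<open>Needed for the measurability of the events below. As \<open>e1 \<le> \<alpha>\<close>,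
  the Hessian is continuous on the closed set \<open>C\<close>, and there the eigenvalue condition
  is an intersection of closed conditions, one for each \<open>v\<close>.\<close>

lemma closed_second_order_critical:
  fixes g :: "real^'n \<Rightarrow> real"
  assumes A1: "assumption_A1 g L1" and A2: "assumption_A2 g \<alpha> \<beta> L2"
    and \<beta>: "\<beta> > 0" and e1: "e1 \<le> \<alpha>"
  shows "closed {x. second_order_critical g e1 e2 x}"
proof -
  have diff: "\<And>x. g differentiable (at x)"
    and lip: "\<And>x y. norm (grad g x - grad g y) \<le> L1 * norm (x - y)"
    using A1 by (auto simp: assumption_A1_def)
  have tw: "grad g differentiable (at x)" and cont: "isCont (hess g) x" if "norm (grad g x) \<le> \<alpha>" for x
  proof -
    have "continuous_on (cball x \<beta>) (hess g)"
      using A2 that by (auto simp: assumption_A2_def)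
    then have "continuous_on (ball x \<beta>) (hess g)"
      by (rule continuous_on_subset) auto
    then show "isCont (hess g) x"
      using \<beta> by (simp add: continuous_on_eq_continuous_at)
    show "grad g differentiable (at x)"
      using A2 that \<beta> by (auto simp: assumption_A2_def)
  qed
  \<comment> \<open>\<open>lipschitz_on\<close> includes nonnegativity of the constant, while
    \<open>L1\<close> carries no sign here; a negative \<open>L1\<close> would force a constant
    gradient.\<close>
  have "L1-lipschitz_on UNIV (grad g) \<or> L1 < 0"
    using lip by (auto simp: lipschitz_on_def dist_norm)
  then have cg: "continuous_on UNIV (grad g)"
  proof
    assume "L1 < 0"
    then have "norm (grad g x - grad g y) \<le> 0" for x y
      using lip[of x y] by (smt (verit) mult_nonpos_nonneg norm_ge_zero)
    then have "grad g = (\<lambda>_. grad g 0)" by auto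
    then show ?thesis by (metis continuous_on_const)
  qed (auto intro: lipschitz_on_continuous_on)
  define C where "C = {x. norm (grad g x) \<le> e1}"
  have C: "closed C"
    unfolding C_def using cg by (intro closed_Collect_le continuous_on_norm continuous_on_const)
  have hc: "continuous_on C (hess g)"
    unfolding C_def using cont e1 by (auto intro!: continuous_at_imp_continuous_on)
  have "{x. second_order_critical g e1 e2 x}
      = C \<inter> (\<Inter>v. {x \<in> C. - e2 * (norm v)\<^sup>2 \<le> v \<bullet> (hess g x *v v)})"
    unfolding second_order_critical_def C_def
    using lambda_min_ge_iff[OF hess_symmetric[OF diff tw]] e1 by fastforce
  moreover have "closed {x \<in> C. - e2 * (norm v)\<^sup>2 \<le> v \<bullet> (hess g x *v v)}" for v
    using C hc unfolding matrix_vector_mult_def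
    by (intro continuous_on_closed_Collect_le continuous_intros)
  ultimately show ?thesis using C by (simp only:) (intro closed_Int closed_INT ballI)
qed

section \<open>Descent, localisation and coupling\<close>

text \<open>The analysis of the dynamics rests on these relations, stated without division, and not
  on the closed formulas. \<open>\<kappa>\<close> is \<open>(1 + a)\<^sup>2 / (1 - a)\<close>, so
  that \<open>\<eta>\<close> is \<open>1 / (\<kappa> * L1)\<close>.\<close>

locale inexact_descent =
  fixes g :: "real^'n \<Rightarrow> real" and G :: "real^'n \<Rightarrow> real^'n"
    and L1 L2 \<alpha> \<beta> a b e1 e2 \<gamma> \<kappa> \<eta> M R F r :: real
  assumes A1: "assumption_A1 g L1" and A2: "assumption_A2 g \<alpha> \<beta> L2"
    and G_inexact: "inexact_oracle g G a b"
    and G_meas: "G \<in> borel_measurable borel"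
    and L1: "0 < L1" and L2: "0 < L2" and \<beta>: "0 < \<beta>"
    and e1: "0 < e1" "e1 < \<alpha>" and e2: "0 < e2" "e2 < L1"
    and a: "0 \<le> a" "a \<le> 1 / 20" and b: "0 \<le> b" "b \<le> e1 / 64"
    and \<gamma>: "20 \<le> \<gamma>"
    and \<kappa>: "\<kappa> * (1 - a) = (1 + a)\<^sup>2"
    and \<eta>: "\<eta> * \<kappa> * L1 = 1"
    and M: "\<eta> * M * e2 = \<gamma>"
    and R: "4 * \<gamma> * L2 * R = e2" "R \<le> \<beta>"
    and F: "50 * \<kappa> * M * \<eta> * F = R\<^sup>2"
    and b_F: "40 * \<eta> * M * b\<^sup>2 \<le> F"
    and r: "0 < r" "1000 * \<eta> * r\<^sup>2 \<le> F"
    and a_L1: "a * (L1 * \<eta> * M * 2 powr (\<gamma> + 2)) \<le> 1"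
    and a_e1: "a * (e1 * \<eta> * M * 2 powr (\<gamma> + 2)) \<le> R"
    and b_R: "b * (M * \<eta> * 2 powr (\<gamma> + 2)) \<le> R"
begin

lemma diff: "g differentiable (at x)"
  and lip: "norm (grad g x - grad g y) \<le> L1 * norm (x - y)"
  and bdd: "bdd_below (range g)"
  using A1 by (auto simp: assumption_A1_def)

lemma G_error: "norm (G x - grad g x) \<le> a * norm (grad g x) + b"
  using G_inexact by (auto simp: inexact_oracle_def norm_minus_commute)

lemma \<kappa>_bounds: "1 \<le> \<kappa>" "\<kappa> \<le> 117 / 100"
proof -
  have eq: "(1 - a) * \<kappa> = 1 + 2 * a + a * a"
    by (subst mult.commute, subst \<kappa>) (simp add: power2_eq_square algebra_simps)
  have "0 \<le> a * a" by simp
  then have "(1 - a) * 1 \<le> (1 - a) * \<kappa>"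
    unfolding eq using a by simp
  then show "1 \<le> \<kappa>" using a by (subst (asm) mult_le_cancel_left_pos) auto
  have "a * a \<le> 1 / 20 * a" using a by (intro mult_right_mono)
  then have "(1 - a) * \<kappa> \<le> (1 - a) * (117 / 100)"
    unfolding eq using a by (simp add: algebra_simps)
  then show "\<kappa> \<le> 117 / 100" using a by (subst (asm) mult_le_cancel_left_pos) auto
qed

lemma \<eta>_pos: "0 < \<eta>"
proof -
  have "0 < \<eta> * (\<kappa> * L1)" using \<eta> by (simp add: mult.assoc)
  moreover have "0 < \<kappa> * L1" using \<kappa>_bounds(1) L1 by simp
  ultimately show ?thesis by (rule zero_less_mult_pos2)
qed

lemma \<eta>L1: "\<eta> * L1 \<le> 1"
  using \<eta> \<eta>_pos L1 \<kappa>_bounds(1) mult_left_mono[of 1 \<kappa> "\<eta> * L1"] by (simp add: mult_ac)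

lemma M_ge: "20 \<le> M"
proof -
  have "\<eta> * e2 \<le> 1" using \<eta>L1 e2 \<eta>_pos mult_left_mono[of e2 L1 \<eta>] by linarith
  have "0 < M * (\<eta> * e2)" using M \<gamma> by (simp add: mult_ac)
  then have "0 < M" using \<eta>_pos e2 by (intro zero_less_mult_pos2[of M "\<eta> * e2"]) simp_all
  then have "M * (\<eta> * e2) \<le> M * 1" using \<open>\<eta> * e2 \<le> 1\<close> by (intro mult_left_mono) auto
  then show ?thesis using M \<gamma> by (simp add: mult_ac)
qed

lemma R_pos: "0 < R"
proof -
  have "0 < (4 * \<gamma> * L2) * R" using R(1) e2 by simp
  then show ?thesis by (rule zero_less_mult_pos) (use \<gamma> L2 in simp)
qed

lemma F_pos: "0 < F"
proof -
  have "0 < (50 * \<kappa> * M * \<eta>) * F" using F R_pos by simp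
  moreover have "0 < 50 * \<kappa> * M * \<eta>" using \<kappa>_bounds M_ge \<eta>_pos by simp
  ultimately show ?thesis by (rule zero_less_mult_pos)
qed

section \<open>Decrease and length of a single step\<close>

text \<open>By the choice of \<open>\<eta>\<close> the quadratic term of the descent inequality uses
  half of the linear gain \<open>(1 - a) * n\<^sup>2\<close>, the cross terms use another quarter,
  and a quarter remains. A general \<open>w\<close> covers the plain step, with
  \<open>c = b\<close>, and the perturbed one, with \<open>c = b + r\<close>.\<close>

lemma step_decrease:
  assumes w: "norm (w - grad g x) \<le> a * norm (grad g x) + c" and c: "0 \<le> c"
  shows "g (x - \<eta> *\<^sub>R w) \<le> g x - \<eta> * (1 - a) / 4 * (norm (grad g x))\<^sup>2 + 5 * \<eta> * c\<^sup>2"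
proof -
  define n where "n = norm (grad g x)"
  have n: "0 \<le> n" by (simp add: n_def)
  have nw: "norm w \<le> (1 + a) * n + c"
    using norm_triangle_sub[of w "grad g x"] w by (simp add: n_def algebra_simps)
  have "grad g x \<bullet> w = n\<^sup>2 + grad g x \<bullet> (w - grad g x)"
    by (simp add: n_def inner_diff_right power2_norm_eq_inner)
  moreover have "\<bar>grad g x \<bullet> (w - grad g x)\<bar> \<le> n * (a * n + c)"
    using w by (intro order_trans[OF Cauchy_Schwarz_ineq2]) (simp add: n_def mult_left_mono)
  ultimately have ip: "n\<^sup>2 - n * (a * n + c) \<le> grad g x \<bullet> w" by linarith
  define \<theta> where "\<theta> = \<eta> * L1"
  have \<theta>: "0 \<le> \<theta>" "\<theta> \<le> 1" "\<theta> * (1 + a)\<^sup>2 = 1 - a"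
    using \<eta>_pos L1 \<eta>L1 \<eta> by (auto simp: \<theta>_def mult_ac simp flip: \<kappa>)
  have "0 \<le> a * a" using a by simp
  then have "(1 - a) * (1 + a) \<le> 1 * (1 + a)\<^sup>2"
    using a by (simp add: power2_eq_square algebra_simps)
  then have "(1 + a) * (1 + a) * (\<theta> * (1 + a)) \<le> (1 + a) * (1 + a) * 1"
    using \<theta>(3) a by (simp add: power2_eq_square mult_ac)
  then have \<theta>': "\<theta> * (1 + a) \<le> 1" using a by (subst (asm) mult_le_cancel_left_pos) auto
  have "\<theta> * (norm w)\<^sup>2 \<le> \<theta> * ((1 + a) * n + c)\<^sup>2"
    using nw \<theta> by (intro mult_left_mono power_mono) auto
  also have "\<dots> = (\<theta> * (1 + a)\<^sup>2) * n\<^sup>2 + 2 * (\<theta> * (1 + a)) * (n * c) + \<theta> * c\<^sup>2"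
    by (simp add: power2_eq_square algebra_simps)
  also have "\<dots> \<le> (1 - a) * n\<^sup>2 + 2 * 1 * (n * c) + 1 * c\<^sup>2"
    unfolding \<theta>(3) using \<theta> \<theta>' n c by (intro add_mono mult_right_mono mult_left_mono) auto
  finally have q: "\<theta> * (norm w)\<^sup>2 \<le> (1 - a) * n\<^sup>2 + 2 * (n * c) + c\<^sup>2" by simp
  have "g (x - \<eta> *\<^sub>R w) \<le> g x - \<eta> * (grad g x \<bullet> w) + L1 / 2 * (\<eta>\<^sup>2 * (norm w)\<^sup>2)"
    using descent_inequality[of g L1 x "- \<eta> *\<^sub>R w", OF diff lip]
    by (simp add: power_mult_distrib)
  also have "\<dots> = g x + \<eta> * (\<theta> * (norm w)\<^sup>2 / 2 - grad g x \<bullet> w)"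
    by (simp add: \<theta>_def algebra_simps power2_eq_square)
  also have "\<theta> * (norm w)\<^sup>2 / 2 - grad g x \<bullet> w \<le> - (1 - a) / 4 * n\<^sup>2 + 5 * c\<^sup>2"
  proof -
    \<comment> \<open>Young's inequality, weighted so that 100/441 fits below
      \<open>(1 - a) / 4\<close>, which is at least 19/80, and 441/100 fits below 9/2.\<close>
    have "0 \<le> (n * (10 / 21) - 21 / 10 * c)\<^sup>2" by simp
    then have "2 * (n * c) \<le> 100 / 441 * n\<^sup>2 + 441 / 100 * c\<^sup>2"
      by (simp add: power2_eq_square algebra_simps)
    also have "\<dots> \<le> (1 - a) / 4 * n\<^sup>2 + 9 / 2 * c\<^sup>2"
      using a by (intro add_mono mult_right_mono) auto
    finally have "2 * (n * c) \<le> (1 - a) / 4 * n\<^sup>2 + 9 / 2 * c\<^sup>2" .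
    moreover have "n * (a * n + c) = a * n\<^sup>2 + n * c" "(1 - a) * n\<^sup>2 = n\<^sup>2 - a * n\<^sup>2"
      "(1 - a) / 4 * n\<^sup>2 = n\<^sup>2 / 4 - a * n\<^sup>2 / 4" "- (1 - a) / 4 * n\<^sup>2 = a * n\<^sup>2 / 4 - n\<^sup>2 / 4"
      by (simp_all add: power2_eq_square field_simps)
    ultimately show ?thesis using q ip by linarith
  qed
  finally show ?thesis
    using \<eta>_pos by (simp add: n_def field_simps)
qed

text \<open>An orbit that moves far must lower \<open>g\<close>: the squared length is bounded by
  the squared gradient norm, which \<open>step_decrease\<close> bounds by the decrease. The 50
  covers \<open>40 * \<kappa> + 2\<close>.\<close>

lemma step_length:
  assumes w: "norm (w - grad g x) \<le> a * norm (grad g x) + c" and c: "0 \<le> c"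
  shows "(norm (\<eta> *\<^sub>R w))\<^sup>2 \<le> 8 * \<eta> * \<kappa> * (g x - g (x - \<eta> *\<^sub>R w)) + 50 * \<eta>\<^sup>2 * c\<^sup>2"
proof -
  define n where "n = norm (grad g x)"
  have nw: "norm w \<le> (1 + a) * n + c"
    using norm_triangle_sub[of w "grad g x"] w by (simp add: n_def algebra_simps)
  have "(norm w)\<^sup>2 \<le> ((1 + a) * n + c)\<^sup>2"
    using nw by (intro power_mono) auto
  also have "\<dots> \<le> 2 * ((1 + a) * n)\<^sup>2 + 2 * c\<^sup>2"
    by (smt (verit) power2_sum power2_diff zero_le_power2)
  finally have nw2: "(norm w)\<^sup>2 \<le> 2 * (\<kappa> * (1 - a)) * n\<^sup>2 + 2 * c\<^sup>2"
    by (simp add: power_mult_distrib \<kappa>)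
  have "(norm (\<eta> *\<^sub>R w))\<^sup>2 \<le> \<eta>\<^sup>2 * (2 * (\<kappa> * (1 - a)) * n\<^sup>2 + 2 * c\<^sup>2)"
    using nw2 by (simp add: power_mult_distrib mult_left_mono)
  also have "\<dots> = 8 * \<eta> * \<kappa> * (\<eta> * (1 - a) / 4 * n\<^sup>2) + 2 * \<eta>\<^sup>2 * c\<^sup>2"
    by (simp add: power2_eq_square field_simps)
  also have "\<dots> \<le> 8 * \<eta> * \<kappa> * (g x - g (x - \<eta> *\<^sub>R w) + 5 * \<eta> * c\<^sup>2) + 2 * \<eta>\<^sup>2 * c\<^sup>2"
    using step_decrease[OF w c] \<eta>_pos \<kappa>_bounds
    by (intro add_mono mult_left_mono) (auto simp: n_def)
  also have "\<dots> = 8 * \<eta> * \<kappa> * (g x - g (x - \<eta> *\<^sub>R w)) + (40 * \<kappa> + 2) * (\<eta>\<^sup>2 * c\<^sup>2)"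
    by (simp add: power2_eq_square field_simps)
  also have "\<dots> \<le> 8 * \<eta> * \<kappa> * (g x - g (x - \<eta> *\<^sub>R w)) + 50 * (\<eta>\<^sup>2 * c\<^sup>2)"
    using \<kappa>_bounds by (intro add_left_mono mult_right_mono) auto
  finally show ?thesis by simp
qed

section \<open>Orbits after a perturbation\<close>

text \<open>The perturbed step is not counted. Together with it the window has \<open>M\<close>
  steps, rounded up, which is exactly when the next perturbation becomes possible.\<close>

definition escape_steps :: nat where
  "escape_steps = nat \<lceil>M\<rceil> - 1"

lemma escape_steps: "real escape_steps < M" "M \<le> real escape_steps + 1"
  using M_ge unfolding escape_steps_def by linarith+

text \<open>Index 0 is already the point after the perturbed step; \<open>k\<close> counts the plain
  steps that follow.\<close>

definition orbit :: "real^'n \<Rightarrow> real^'n \<Rightarrow> nat \<Rightarrow> real^'n" where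
  "orbit x u k = ((\<lambda>y. y - \<eta> *\<^sub>R G y) ^^ k) (x - \<eta> *\<^sub>R (G x + u))"

lemma orbit_0: "orbit x u 0 = x - \<eta> *\<^sub>R (G x + u)"
  and orbit_Suc: "orbit x u (Suc k) = orbit x u k - \<eta> *\<^sub>R G (orbit x u k)"
  by (simp_all add: orbit_def)

definition stuck :: "real^'n \<Rightarrow> real^'n \<Rightarrow> bool" where
  "stuck x u \<longleftrightarrow> g (orbit x u escape_steps) > g x - F"

text \<open>Telescoping bounds the sum of the squared step lengths by
  \<open>95 / 10 * (\<eta> * \<kappa> * F)\<close>. Cauchy-Schwarz over at most
  \<open>21 / 20 * M\<close> steps and the relation between \<open>F\<close> and \<open>R\<close>
  then give a squared distance of at most 0.1995 times \<open>R\<^sup>2\<close>.\<close>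

lemma stuck_localized:
  assumes u: "norm u \<le> r" and st: "stuck x u" and k: "k \<le> escape_steps"
  shows "norm (orbit x u k - x) \<le> R / 2"
proof -
  let ?N = "Suc escape_steps"
  define X where "X = case_nat x (orbit x u)"
  define c where "c i = (if i = 0 then b + r else b)" for i :: nat
  define w where "w i = (if i = 0 then G x + u else G (X i))" for i
  have X: "X (Suc i) = X i - \<eta> *\<^sub>R w i" for i
    by (cases i) (simp_all add: X_def w_def orbit_0 orbit_Suc)
  have c: "0 \<le> c i" for i using b r by (simp add: c_def)
  have w: "norm (w i - grad g (X i)) \<le> a * norm (grad g (X i)) + c i" for i
  proof (cases "i = 0")
    case True
    have "norm (G x + u - grad g x) \<le> norm (G x - grad g x) + norm u"
      using norm_triangle_ineq[of "G x - grad g x" u] by (simp add: algebra_simps)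
    then show ?thesis using True u G_error[of x] by (simp add: w_def c_def X_def)
  next
    case False
    then show ?thesis using G_error[of "X i"] by (simp add: w_def c_def)
  qed
  define D where "D i = norm (X (Suc i) - X i)" for i
  have D: "(D i)\<^sup>2 \<le> 8 * \<eta> * \<kappa> * (g (X i) - g (X (Suc i))) + 50 * \<eta>\<^sup>2 * (c i)\<^sup>2" for i
    using step_length[OF w c, of i] by (simp add: D_def X)
  have "(\<Sum>i<?N. (D i)\<^sup>2) \<le> (\<Sum>i<?N. 8 * \<eta> * \<kappa> * (g (X i) - g (X (Suc i))) + 50 * \<eta>\<^sup>2 * (c i)\<^sup>2)"
    by (intro sum_mono D)
  also have "\<dots> = 8 * \<eta> * \<kappa> * (\<Sum>i<?N. g (X i) - g (X (Suc i))) + 50 * \<eta>\<^sup>2 * (\<Sum>i<?N. (c i)\<^sup>2)"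
    by (simp only: sum.distrib sum_distrib_left)
  also have "(\<Sum>i<?N. g (X i) - g (X (Suc i))) = g (X 0) - g (X ?N)"
    by (rule sum_lessThan_telescope')
  also have "\<dots> = g x - g (orbit x u escape_steps)" by (simp add: X_def)
  also have "(\<Sum>i<?N. (c i)\<^sup>2) = (b + r)\<^sup>2 + real escape_steps * b\<^sup>2"
    by (subst sum.lessThan_Suc_shift) (simp add: c_def)
  finally have "(\<Sum>i<?N. (D i)\<^sup>2) \<le> 8 * \<eta> * \<kappa> * (g x - g (orbit x u escape_steps))
      + 50 * \<eta>\<^sup>2 * ((b + r)\<^sup>2 + real escape_steps * b\<^sup>2)" .
  \<comment> \<open>The perturbed step contributes at most
    \<open>2 * b\<^sup>2 + 2 * r\<^sup>2\<close>, and \<open>escape_steps + 2\<close> is at most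
    \<open>11 / 10 * M\<close> because \<open>M\<close> is at least 20.\<close>
  also have "\<dots> \<le> 8 * \<eta> * \<kappa> * F + 50 * \<eta>\<^sup>2 * (11 / 10 * M * b\<^sup>2 + 2 * r\<^sup>2)"
  proof (rule add_mono; rule mult_left_mono)
    show "g x - g (orbit x u escape_steps) \<le> F" using st by (simp add: stuck_def)
    have "(b + r)\<^sup>2 \<le> 2 * b\<^sup>2 + 2 * r\<^sup>2"
      by (smt (verit) power2_sum power2_diff zero_le_power2)
    moreover have "(real escape_steps + 2) * b\<^sup>2 \<le> 11 / 10 * M * b\<^sup>2"
      using escape_steps M_ge by (intro mult_right_mono) auto
    ultimately show "(b + r)\<^sup>2 + real escape_steps * b\<^sup>2 \<le> 11 / 10 * M * b\<^sup>2 + 2 * r\<^sup>2"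
      by (simp add: algebra_simps)
  qed (use \<eta>_pos \<kappa>_bounds in auto)
  also have "\<dots> = \<eta> * (8 * \<kappa> * F + 55 / 40 * (40 * \<eta> * M * b\<^sup>2) + 1 / 10 * (1000 * \<eta> * r\<^sup>2))"
    by (simp add: power2_eq_square algebra_simps)
  also have "\<dots> \<le> \<eta> * (8 * \<kappa> * F + 55 / 40 * (\<kappa> * F) + 1 / 10 * (\<kappa> * F))"
  proof -
    have "F \<le> \<kappa> * F" using \<kappa>_bounds F_pos by simp
    then show ?thesis using b_F r(2) \<eta>_pos by (intro mult_left_mono; linarith)
  qed
  also have "\<dots> \<le> \<eta> * (95 / 10 * (\<kappa> * F))"
    using \<eta>_pos \<kappa>_bounds F_pos by (intro mult_left_mono) auto
  finally have SD: "(\<Sum>i<?N. (D i)\<^sup>2) \<le> 95 / 10 * (\<eta> * \<kappa> * F)" by simp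
  have "norm (X (Suc k) - X 0) \<le> (\<Sum>i<Suc k. D i)"
    unfolding sum_lessThan_telescope[symmetric] D_def by (rule norm_sum)
  \<comment> \<open>The sum runs over the whole window because \<open>stuck\<close> controls the
    decrease only at its end.\<close>
  also have "\<dots> \<le> (\<Sum>i<?N. D i)"
    using k by (intro sum_mono2) (auto simp: D_def)
  finally have "(norm (orbit x u k - x))\<^sup>2 \<le> (\<Sum>i<?N. D i)\<^sup>2"
    by (intro power_mono) (simp_all add: X_def)
  also have "\<dots> \<le> (\<Sum>i<?N. (D i)\<^sup>2) * real (card {..<?N})"
    by (rule sum_squared_le_sum_of_squares)
  also have "\<dots> \<le> (95 / 10 * (\<eta> * \<kappa> * F)) * (21 / 20 * M)"
    using SD escape_steps M_ge \<eta>_pos \<kappa>_bounds F_pos by (intro mult_mono sum_nonneg) auto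
  also have "\<dots> = 9975 / 1000 / 50 * (50 * \<kappa> * M * \<eta> * F)" by simp
  also have "\<dots> \<le> (R / 2)\<^sup>2" unfolding F by (simp add: power_divide)
  finally show ?thesis by (rule power2_le_imp_le) (use R_pos in simp)
qed

text \<open>Transfers the test on the oracle to the gradient. At a point that triggers a
  perturbation the Hessian assumption therefore applies, and only the eigenvalue condition can
  fail.\<close>

lemma grad_small:
  assumes "norm (G x) \<le> e1 / 2"
  shows "norm (grad g x) \<le> 11 / 20 * e1"
proof -
  have "norm (grad g x) \<le> norm (G x) + norm (G x - grad g x)"
    by (metis norm_triangle_sub norm_minus_commute)
  then have "(1 - a) * norm (grad g x) \<le> 33 / 64 * e1"
    using assms G_error[of x] b by (simp add: algebra_simps)
  moreover have "95 / 100 * norm (grad g x) \<le> (1 - a) * norm (grad g x)"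
    using a by (intro mult_right_mono) auto
  ultimately show ?thesis using e1 by simp
qed

section \<open>Coupling of two orbits\<close>

text \<open>The 5 makes the growth decisive: a difference \<open>\<eta> * gap\<close>, multiplied by
  \<open>2 powr \<gamma> / 2\<close> and halved for the errors, is \<open>5 / 4 * R\<close>, while
  two localised orbits are at most \<open>R\<close> apart.\<close>

definition gap :: real where
  "gap = 5 * R / (\<eta> * 2 powr \<gamma>)"

lemma gap_pos: "0 < gap"
  using R_pos \<eta>_pos by (simp add: gap_def)

text \<open>Convexity gives \<open>2 powr y \<le> 1 + y\<close> on the unit interval, and
  \<open>y * M = \<gamma>\<close>. Having \<open>escape_steps\<close> instead of \<open>M\<close>
  factors lowers the exponent by at most \<open>y \<le> 1\<close>, hence the division by 2.\<close>

lemma growth_factor: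
  assumes "e2 \<le> l"
  shows "2 powr \<gamma> / 2 \<le> (1 + \<eta> * l) ^ escape_steps"
proof -
  define y where "y = \<eta> * e2"
  have y: "0 < y" "y \<le> 1" using \<eta>_pos e2 \<eta>L1 unfolding y_def
    using mult_left_mono[of e2 L1 \<eta>] by (simp, linarith)
  have "exp ((1 - y) *\<^sub>R 0 + y *\<^sub>R ln 2) \<le> (1 - y) * exp 0 + y * exp (ln 2 :: real)"
    using y by (intro convex_onD[OF exp_convex]) auto
  then have yb: "2 powr y \<le> 1 + y" by (simp add: powr_def)
  have "\<gamma> - 1 \<le> y * M - y" using M y by (simp add: y_def mult_ac)
  also have "\<dots> \<le> y * real escape_steps"
    using mult_left_mono[of M "real escape_steps + 1" y] escape_steps(2) y by (simp add: algebra_simps)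
  finally have "2 powr (\<gamma> - 1) \<le> 2 powr (y * real escape_steps)" by simp
  also have "\<dots> = (2 powr y) ^ escape_steps" by (simp add: powr_powr flip: powr_realpow)
  also have "\<dots> \<le> (1 + y) ^ escape_steps" by (intro power_mono yb) auto
  also have "\<dots> \<le> (1 + \<eta> * l) ^ escape_steps"
    using y assms \<eta>_pos unfolding y_def by (intro power_mono) auto
  finally show ?thesis by (simp add: powr_diff)
qed

text \<open>Mean value inequality for the gradient minus its linear part at \<open>x\<close>, on a
  ball contained in the one where the Hessian is Lipschitz.\<close>

lemma hess_linearization:
  assumes x: "norm (grad g x) \<le> \<alpha>" and y: "norm (y - x) \<le> R / 2" and z: "norm (z - x) \<le> R / 2"
  shows "norm (grad g y - grad g z - hess g x *v (y - z)) \<le> L2 * (R / 2) * norm (y - z)"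
proof -
  let ?f = "\<lambda>w. grad g w - hess g x *v w"
  have A: "\<And>w. w \<in> cball x \<beta> \<Longrightarrow> grad g differentiable (at w)"
    "\<And>w. w \<in> cball x \<beta> \<Longrightarrow> opnorm (hess g w - hess g x) \<le> L2 * norm (w - x)"
    using A2 x \<beta> unfolding assumption_A2_def by auto
  have sub: "w \<in> cball x \<beta>" "norm (w - x) \<le> R / 2" if "w \<in> cball x (R / 2)" for w
    using that R R_pos by (auto simp: dist_norm norm_minus_commute)
  have "norm (?f y - ?f z) \<le> L2 * (R / 2) * norm (y - z)"
  proof (rule differentiable_bound[where f = ?f and S = "cball x (R / 2)" and f' = "\<lambda>w h. (hess g w - hess g x) *v h"])
    fix w assume w: "w \<in> cball x (R / 2)"
    have "(?f has_derivative (\<lambda>h. hess g w *v h - hess g x *v h)) (at w)"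
      by (rule has_derivative_diff[OF has_derivative_hess[OF A(1)[OF sub(1)[OF w]]]
            bounded_linear_imp_has_derivative[OF matrix_vector_mul_bounded_linear]])
    then show "(?f has_derivative (\<lambda>h. (hess g w - hess g x) *v h)) (at w within cball x (R / 2))"
      unfolding matrix_vector_mult_diff_rdistrib by (rule has_derivative_at_withinI)
    have "opnorm (hess g w - hess g x) \<le> L2 * norm (w - x)" by (rule A(2)[OF sub(1)[OF w]])
    also have "\<dots> \<le> L2 * (R / 2)" using sub(2)[OF w] L2 by (intro mult_left_mono) auto
    finally show "onorm (\<lambda>h. (hess g w - hess g x) *v h) \<le> L2 * (R / 2)" by (simp add: opnorm_def)
  qed (use y z in \<open>auto simp: dist_norm norm_minus_commute\<close>)
  then show ?thesis by (simp add: matrix_vector_mult_diff_distrib algebra_simps)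
qed

text \<open>\<open>B\<close> is positive semidefinite because \<open>\<eta> * L1 \<le> 1\<close>, so
  its norm is the eigenvalue \<open>\<mu>\<close> at \<open>e\<close>, and the difference of two
  stuck orbits is a power iteration of \<open>B\<close> with errors. The direction \<open>e\<close>
  depends on \<open>x\<close> alone, which makes the stuck set thin in one fixed direction.\<close>

lemma coupled_orbits_separate:
  assumes x: "norm (G x) \<le> e1 / 2" "\<not> second_order_critical g e1 e2 x"
  obtains e where "norm e = 1"
    "\<And>u s. norm u \<le> r \<Longrightarrow> norm (u + s *\<^sub>R e) \<le> r \<Longrightarrow> gap \<le> s \<Longrightarrow> stuck x u \<Longrightarrow> \<not> stuck x (u + s *\<^sub>R e)"
proof -
  define H where "H = hess g x"
  have gx: "norm (grad g x) \<le> 11 / 20 * e1" by (rule grad_small[OF x(1)])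
  then have gx': "norm (grad g x) \<le> \<alpha>" "norm (grad g x) \<le> e1" using e1 by auto
  have tw: "grad g differentiable (at x)" using A2 gx' \<beta> by (auto simp: assumption_A2_def)
  have sym: "(H *v u) \<bullet> v = u \<bullet> (H *v v)" for u v
    unfolding H_def by (rule hess_symmetric[OF diff tw])
  define l where "l = - lambda_min H"
  have l: "e2 < l" using x(2) gx' by (simp add: second_order_critical_def l_def H_def)
  obtain e where e: "norm e = 1" "H *v e = lambda_min H *\<^sub>R e"
    "\<And>v. lambda_min H * (norm v)\<^sup>2 \<le> v \<bullet> (H *v v)"
    using lambda_min_symmetric[OF sym] by blast
  define B where "B v = v - \<eta> *\<^sub>R (H *v v)" for v
  define \<mu> where "\<mu> = 1 + \<eta> * l"
  have lin: "linear B" unfolding B_def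
    by (intro linear_compose_sub linear_compose_scale_right matrix_vector_mul_linear linear_id[unfolded id_def])
  have Bsym: "B u \<bullet> v = u \<bullet> B v" for u v by (simp add: B_def inner_simps sym)
  have Bnorm: "norm (B v) \<le> \<mu> * norm v" for v
  proof (rule psd_norm_le[OF lin Bsym])
    fix v
    have "v \<bullet> (H *v v) \<le> norm v * norm (H *v v)" by (rule norm_cauchy_schwarz)
    also have "\<dots> \<le> norm v * (L1 * norm v)"
      unfolding H_def by (intro mult_left_mono hess_norm_le[OF tw lip]) auto
    finally have "\<eta> * (v \<bullet> (H *v v)) \<le> \<eta> * (L1 * (v \<bullet> v))"
      using \<eta>_pos by (simp add: power2_eq_square mult_ac flip: power2_norm_eq_inner)
    also have "\<dots> \<le> 1 * (v \<bullet> v)" using mult_right_mono[OF \<eta>L1, of "v \<bullet> v"] by simp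
    finally show "0 \<le> v \<bullet> B v" by (simp add: B_def inner_simps)
    show "v \<bullet> B v \<le> \<mu> * (norm v)\<^sup>2"
      using mult_left_mono[OF e(3)[of v], of \<eta>] \<eta>_pos
      by (simp add: B_def inner_simps \<mu>_def l_def power2_norm_eq_inner algebra_simps)
  qed
  have Be: "B e = \<mu> *\<^sub>R e" by (simp add: B_def e(2) \<mu>_def l_def algebra_simps)
  have \<mu>: "\<mu> \<ge> 1" using \<eta>_pos l e2 by (simp add: \<mu>_def)
  have False
    if u: "norm u \<le> r" "norm (u + s *\<^sub>R e) \<le> r" "gap \<le> s" "stuck x u" "stuck x (u + s *\<^sub>R e)" for u s
  proof -
    define X where "X = orbit x u"
    define Y where "Y = orbit x (u + s *\<^sub>R e)"
    define z where "z k = X k - Y k" for k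
    have s: "0 < s" using u(3) gap_pos by simp
    have XR: "norm (X k - x) \<le> R / 2" and YR: "norm (Y k - x) \<le> R / 2" if "k \<le> escape_steps" for k
      unfolding X_def Y_def using stuck_localized u that by blast+
    have z0: "z 0 = (\<eta> * s) *\<^sub>R e" by (simp add: z_def X_def Y_def orbit_0 algebra_simps)
    \<comment> \<open>The oracle error on the whole ball: the gradient bound at \<open>x\<close>
      plus its variation over distance \<open>R / 2\<close>.\<close>
    define \<epsilon> where "\<epsilon> = a * (11 / 20 * e1 + L1 * (R / 2)) + b"
    have err: "norm (G y - grad g y) \<le> \<epsilon>" if "norm (y - x) \<le> R / 2" for y
    proof -
      have "norm (grad g y) \<le> norm (grad g x) + norm (grad g y - grad g x)"
        by (metis norm_triangle_sub)
      also have "\<dots> \<le> 11 / 20 * e1 + L1 * (R / 2)"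
        using gx lip[of y x] mult_left_mono[OF that, of L1] L1 by linarith
      finally have "a * norm (grad g y) \<le> a * (11 / 20 * e1 + L1 * (R / 2))"
        using a by (intro mult_left_mono) auto
      then show ?thesis using G_error[of y] by (simp add: \<epsilon>_def)
    qed
    have noise: "\<eta> * (2 * \<epsilon>) \<le> \<eta> * s / (4 * M)"
    proof -
      let ?q = "\<eta> * M * 2 powr (\<gamma> + 2)"
      have q: "0 < ?q" using \<eta>_pos M_ge by simp
      have "\<epsilon> * ?q = 11 / 20 * (a * (e1 * ?q)) + R / 2 * (a * (L1 * ?q)) + b * ?q"
        by (simp add: \<epsilon>_def algebra_simps)
      \<comment> \<open>The three smallness conditions on \<open>a\<close> and \<open>b\<close> add
        up to 2.05 times \<open>R\<close>, within the \<open>5 / 2 * R\<close> that the 5 in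
        \<open>gap\<close> provides.\<close>
      also have "\<dots> \<le> 11 / 20 * R + R / 2 * 1 + R"
        using a_L1 a_e1 b_R R_pos by (intro add_mono mult_left_mono) (auto simp: mult_ac)
      also have "\<dots> \<le> 5 / 2 * R" using R_pos by simp
      finally have "2 * \<epsilon> * ?q \<le> 5 * R" by simp
      also have "5 * R = \<eta> * gap * 2 powr \<gamma>" using \<eta>_pos by (simp add: gap_def)
      also have "\<dots> \<le> \<eta> * s * 2 powr \<gamma>" using u(3) \<eta>_pos by simp
      also have "\<dots> = s / (4 * M) * ?q" using M_ge by (simp add: powr_add)
      finally have "2 * \<epsilon> \<le> s / (4 * M)" using q by (simp only: mult_le_cancel_right_pos)
      then show ?thesis using \<eta>_pos mult_left_mono[of "2 * \<epsilon>" "s / (4 * M)" \<eta>] by simp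
    qed
    \<comment> \<open>The relations for \<open>R\<close> and \<open>M\<close> make
      \<open>\<eta>\<close> times the linearisation error exactly the \<open>1 / (8 * M)\<close>
      tolerated by the power iteration.\<close>
    have "\<eta> * M * (4 * \<gamma> * L2 * R) = \<gamma>" by (simp only: R(1) M)
    then have "\<gamma> * (4 * \<eta> * L2 * R * M) = \<gamma> * 1" by (simp add: mult_ac)
    then have "4 * \<eta> * L2 * R * M = 1" using \<gamma> by simp
    then have \<rho>: "\<eta> * (L2 * (R / 2)) = 1 / (8 * M)" using M_ge by (simp add: field_simps)
    have "\<mu> ^ escape_steps * \<bar>\<eta> * s\<bar> / 2 \<le> norm (z escape_steps)"
    proof (rule perturbed_power_iteration_growth[where B = B and \<mu> = \<mu> and e = e and M = M and z = z
          and c = "\<eta> * s" and n = escape_steps, OF lin Bnorm Be e(1) \<mu> _ z0])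
      show "0 < M" "real escape_steps \<le> M" using M_ge escape_steps by auto
      fix t assume t: "t < escape_steps"
      let ?A = "grad g (X t) - grad g (Y t) - H *v (X t - Y t)"
      let ?E = "(G (X t) - grad g (X t)) - (G (Y t) - grad g (Y t))"
      have "z (Suc t) - B (z t) = - (\<eta> *\<^sub>R (?A + ?E))"
        by (simp add: z_def X_def Y_def orbit_Suc B_def algebra_simps)
      then have n: "norm (z (Suc t) - B (z t)) = \<eta> * norm (?A + ?E)"
        using \<eta>_pos by simp
      have A: "norm ?A \<le> L2 * (R / 2) * norm (X t - Y t)"
        unfolding H_def using hess_linearization[OF gx'(1) XR YR] t by simp
      have E: "norm ?E \<le> \<epsilon> + \<epsilon>"
        using err[OF XR[of t]] err[OF YR[of t]] t
          norm_triangle_ineq4[of "G (X t) - grad g (X t)" "G (Y t) - grad g (Y t)"] by simp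
      have "norm (z (Suc t) - B (z t)) \<le> \<eta> * (L2 * (R / 2) * norm (X t - Y t) + (\<epsilon> + \<epsilon>))"
        unfolding n using \<eta>_pos norm_triangle_le[OF add_mono[OF A E]] by (intro mult_left_mono) auto
      also have "\<dots> = (\<eta> * (L2 * (R / 2))) * norm (z t) + \<eta> * (2 * \<epsilon>)"
        by (simp add: z_def algebra_simps)
      also have "\<dots> \<le> 1 / (8 * M) * norm (z t) + \<bar>\<eta> * s\<bar> / (4 * M)"
        unfolding \<rho> using noise s \<eta>_pos by (simp add: abs_mult)
      finally show "norm (z (Suc t) - B (z t)) \<le> 1 / (8 * M) * norm (z t) + \<bar>\<eta> * s\<bar> / (4 * M)" .
    qed
    moreover have "norm (z escape_steps) \<le> R"
      using XR[of escape_steps] YR[of escape_steps]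
        norm_triangle_ineq4[of "X escape_steps - x" "Y escape_steps - x"] by (simp add: z_def)
    moreover have "2 powr \<gamma> / 2 * (\<eta> * gap) \<le> \<mu> ^ escape_steps * \<bar>\<eta> * s\<bar>"
      using growth_factor[of l] l u(3) \<eta>_pos gap_pos \<mu>
      by (intro mult_mono) (auto simp flip: \<mu>_def)
    moreover have "2 powr \<gamma> / 2 * (\<eta> * gap) = 5 / 2 * R" using \<eta>_pos by (simp add: gap_def)
    ultimately show False using R_pos by simp
  qed
  with e(1) that show ?thesis by blast
qed

end

section \<open>Failure probability\<close>

text \<open>The state at time \<open>t\<close> is a function of the samples before \<open>t\<close>;
  this is the source of its independence from \<open>xi t\<close>.\<close>

lemma pigd_state_cong:
  assumes "\<And>i. i < t \<Longrightarrow> xi i = xi' i"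
  shows "pigd_state G \<eta> M e1 x0 xi t = pigd_state G \<eta> M e1 x0 xi' t"
  using assms by (induction t) (simp_all add: Let_def case_prod_unfold)

lemma measurable_pigd_state:
  fixes G :: "real^'n \<Rightarrow> real^'n"
  assumes [measurable]: "G \<in> borel_measurable borel" and N: "sets N = sets borel"
  shows "(\<lambda>xi. pigd_state G \<eta> M e1 x0 xi t)
           \<in> measurable (PiM UNIV (\<lambda>_. N)) (borel \<Otimes>\<^sub>M borel)"
proof (induction t)
  case (Suc t)
  note [measurable] = Suc.IH
  have "(\<lambda>xi. xi t) \<in> measurable (PiM UNIV (\<lambda>_. N)) N"
    by (rule measurable_component_singleton) simp
  then have [measurable]: "(\<lambda>xi. xi t) \<in> measurable (PiM UNIV (\<lambda>_. N)) borel"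
    by (simp cong: measurable_cong_sets add: N)
  show ?case
    by (simp add: Let_def case_prod_unfold)
qed simp

context inexact_descent
begin

abbreviation iterate :: "real^'n \<Rightarrow> (nat \<Rightarrow> real^'n) \<Rightarrow> nat \<Rightarrow> real^'n" where
  "iterate \<equiv> pigd_iter G \<eta> M e1"

abbreviation uniform_noise :: "(real^'n) measure" where
  "uniform_noise \<equiv> uniform_measure lborel (cball 0 r)"

lemma g_measurable [measurable]: "g \<in> borel_measurable borel"
  by (intro borel_measurable_continuous_onI continuous_at_imp_continuous_on ballI
      differentiable_imp_continuous_within diff)

lemma orbit_measurable [measurable]:
  "(\<lambda>p. orbit (fst p) (snd p) k) \<in> borel_measurable (borel \<Otimes>\<^sub>M borel)"
proof (induction k)
  case 0
  note [measurable] = G_meas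
  show ?case unfolding orbit_0 by measurable
next
  case (Suc k)
  note [measurable] = G_meas Suc.IH
  show ?case unfolding orbit_Suc by measurable
qed

lemma stuck_measurable [measurable]:
  "Measurable.pred (borel \<Otimes>\<^sub>M borel) (\<lambda>p. stuck (fst p) (snd p))"
  unfolding stuck_def by measurable

lemma second_order_critical_measurable [measurable]:
  "Measurable.pred borel (second_order_critical g e1 e2)"
  using closed_second_order_critical[OF A1 A2 \<beta>, of e1 e2] e1 by (simp add: pred_def borel_closed)

text \<open>The coupling makes the stuck part of the ball thin along \<open>e\<close> with width
  \<open>gap\<close>, so the volume estimate applies.\<close>

lemma measure_stuck_le:
  assumes x: "norm (G x) \<le> e1 / 2" "\<not> second_order_critical g e1 e2 x"
  shows "measure uniform_noise {u. stuck x u} \<le> 5 / 3 * sqrt (real CARD('n)) * gap / r"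
proof -
  obtain e where e: "norm e = 1"
    "\<And>u s. norm u \<le> r \<Longrightarrow> norm (u + s *\<^sub>R e) \<le> r \<Longrightarrow> gap \<le> s \<Longrightarrow> stuck x u \<Longrightarrow> \<not> stuck x (u + s *\<^sub>R e)"
    using coupled_orbits_separate[OF x] by blast
  have "(\<lambda>u. (x, u)) \<in> measurable borel (borel \<Otimes>\<^sub>M borel)" by simp
  from measurable_compose[OF this stuck_measurable]
  have st: "{u. stuck x u} \<in> sets borel" by (simp add: pred_def)
  define S where "S = cball 0 r \<inter> {u. stuck x u}"
  have Sb: "S \<in> sets borel" unfolding S_def using st by auto
  have S: "S \<in> lmeasurable"
    by (rule fmeasurableI2[of "cball 0 r"]) (use Sb in \<open>auto simp: S_def\<close>)
  have "measure lebesgue S \<le> 5 / 3 * sqrt (real DIM(real^'n)) * gap / r * measure lebesgue (cball 0 r :: (real^'n) set)"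
    by (rule measure_thin_set_le[OF S _ r(1) gap_pos e(1)]) (use e(2) in \<open>auto simp: S_def\<close>)
  then have *: "measure lborel S \<le> 5 / 3 * sqrt (real CARD('n)) * gap / r * measure lborel (cball 0 r :: (real^'n) set)"
    using Sb by (simp add: measure_completion)
  have "measure uniform_noise {u. stuck x u} = measure lborel S / measure lborel (cball 0 r :: (real^'n) set)"
    unfolding S_def using r st
    by (intro measure_uniform_measure) (auto simp: emeasure_cball less_imp_neq[OF unit_ball_vol_pos, symmetric])
  also have "\<dots> \<le> 5 / 3 * sqrt (real CARD('n)) * gap / r"
    using * r by (simp add: divide_le_eq)
  finally show ?thesis .
qed

lemma prob_space_uniform_noise: "prob_space uniform_noise"
  using r by (intro prob_space_uniform_measure) (auto simp: emeasure_cball less_imp_neq[OF unit_ball_vol_pos, symmetric])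

lemma iterate_measurable [measurable]: "(\<lambda>xi. iterate x0 xi t) \<in> borel_measurable (noise_space r)"
proof -
  have "(\<lambda>xi. pigd_state G \<eta> M e1 x0 xi t) \<in> measurable (noise_space r) (borel \<Otimes>\<^sub>M borel)"
    unfolding noise_space_def by (rule measurable_pigd_state[OF G_meas]) simp
  then show ?thesis unfolding pigd_iter_def by measurable
qed

section \<open>Probability of a failing perturbation\<close>

text \<open>Whether the waiting time is over at \<open>t\<close> is left out on purpose: the larger
  event has the same probability bound and depends on the past through the iterate only.\<close>

definition bad_noise :: "real^'n \<Rightarrow> nat \<Rightarrow> (nat \<Rightarrow> real^'n) set" where
  "bad_noise x0 t = {xi \<in> space (noise_space r). norm (G (iterate x0 xi t)) \<le> e1 / 2 \<and>
     \<not> second_order_critical g e1 e2 (iterate x0 xi t) \<and> stuck (iterate x0 xi t) (xi t)}"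

lemma component_measurable [measurable]: "(\<lambda>xi. xi t) \<in> borel_measurable (noise_space r)"
  unfolding noise_space_def
  using measurable_component_singleton[of t UNIV "\<lambda>_. uniform_noise"] by (simp cong: measurable_cong_sets)

lemma bad_noise_sets: "bad_noise x0 t \<in> sets (noise_space r)"
proof -
  note [measurable] = G_meas
  have [measurable]: "Measurable.pred (noise_space r) (\<lambda>xi. stuck (iterate x0 xi t) (xi t))"
    using measurable_compose[OF measurable_Pair[OF iterate_measurable component_measurable] stuck_measurable]
    by simp
  show ?thesis unfolding bad_noise_def by measurable
qed

text \<open>Fubini: \<open>comb_seq t\<close> joins the first \<open>t\<close> samples to an
  independent tail. The prefix fixes the iterate, and the sample used at \<open>t\<close> is entry 0
  of the tail, which is uniform, so every slice obeys the one-point bound.\<close>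

lemma measure_bad_noise_le:
  "measure (noise_space r) (bad_noise x0 t) \<le> 5 / 3 * sqrt (real CARD('n)) * gap / r" (is "_ \<le> ?p")
proof -
  have p: "0 \<le> ?p" using gap_pos r by simp
  interpret U: prob_space uniform_noise by (rule prob_space_uniform_noise)
  interpret sequence_space uniform_noise ..
  have SN: "S = noise_space r" by (simp add: noise_space_def)
  let ?f = "\<lambda>(\<omega>, \<omega>'). comb_seq t \<omega> \<omega>'"
  have f: "?f \<in> measurable (S \<Otimes>\<^sub>M S) S" by (rule measurable_comb_seq)
  have bs: "bad_noise x0 t \<in> sets S" using bad_noise_sets SN by simp
  define X where "X = ?f -` bad_noise x0 t \<inter> space (S \<Otimes>\<^sub>M S)"
  have X: "X \<in> sets (S \<Otimes>\<^sub>M S)" unfolding X_def using f bs by (rule measurable_sets)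
  have slice: "emeasure S (Pair \<omega> -` X) \<le> ennreal ?p" if \<omega>: "\<omega> \<in> space S" for \<omega>
  proof -
    define x where "x = iterate x0 \<omega> t"
    have it: "iterate x0 (comb_seq t \<omega> \<omega>') t = x" for \<omega>'
      unfolding x_def pigd_iter_def by (subst pigd_state_cong[of t _ \<omega>]) (simp_all add: comb_seq_less)
    have c0: "comb_seq t \<omega> \<omega>' t = \<omega>' 0" for \<omega>' by (simp add: comb_seq_def)
    show ?thesis
    proof (cases "norm (G x) \<le> e1 / 2 \<and> \<not> second_order_critical g e1 e2 x")
      case False
      then have "Pair \<omega> -` X = {}" by (auto simp: X_def bad_noise_def it)
      then show ?thesis by simp
    next
      case True
      have "(\<lambda>u. (x, u)) \<in> measurable borel (borel \<Otimes>\<^sub>M borel)" by simp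
      from measurable_compose[OF this stuck_measurable]
      have st: "{u. stuck x u} \<in> sets uniform_noise" by (simp add: pred_def)
      have "Pair \<omega> -` X \<subseteq> (\<lambda>\<omega>'. \<omega>' 0) -` {u. stuck x u} \<inter> space S"
        by (auto simp: X_def bad_noise_def it c0 space_pair_measure)
      then have "emeasure S (Pair \<omega> -` X) \<le> emeasure S ((\<lambda>\<omega>'. \<omega>' 0) -` {u. stuck x u} \<inter> space S)"
        using st by (intro emeasure_mono measurable_sets[OF measurable_component_singleton]) auto
      also have "\<dots> = emeasure (distr S uniform_noise (\<lambda>\<omega>'. \<omega>' 0)) {u. stuck x u}"
        using st by (subst emeasure_distr) auto
      also have "\<dots> = emeasure uniform_noise {u. stuck x u}" by (subst PiM_component) auto
      also have "\<dots> \<le> ennreal ?p"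
        using measure_stuck_le True by (simp add: U.emeasure_eq_measure ennreal_leI)
      finally show ?thesis .
    qed
  qed
  have "emeasure S (bad_noise x0 t) = emeasure (distr (S \<Otimes>\<^sub>M S) S ?f) (bad_noise x0 t)"
    by (simp only: PiM_comb_seq)
  also have "\<dots> = emeasure (S \<Otimes>\<^sub>M S) X"
    unfolding X_def using f bs by (rule emeasure_distr)
  also have "\<dots> = (\<integral>\<^sup>+\<omega>. emeasure S (Pair \<omega> -` X) \<partial>S)"
    by (rule P.emeasure_pair_measure_alt[OF X])
  also have "\<dots> \<le> (\<integral>\<^sup>+\<omega>. ennreal ?p \<partial>S)" by (intro nn_integral_mono slice)
  also have "\<dots> = ennreal ?p" by (simp add: P.emeasure_space_1)
  finally have "ennreal (measure S (bad_noise x0 t)) \<le> ennreal ?p"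
    by (simp only: P.emeasure_eq_measure)
  then show ?thesis using p by (simp only: ennreal_le_iff SN)
qed

section \<open>Progress between perturbations\<close>

text \<open>At most \<open>escape_steps\<close>, hence fewer than \<open>M\<close>, steps have
  passed since \<open>t\<close>, so no second perturbation interferes, whatever the oracle
  returns.\<close>

lemma perturbed_state:
  assumes st: "pigd_state G \<eta> M e1 x0 xi t = (x, tp)" and x: "norm (G x) \<le> e1 / 2"
    and free: "M \<le> real t - tp" and k: "k \<le> escape_steps"
  shows "pigd_state G \<eta> M e1 x0 xi (Suc t + k) = (orbit x (xi t) k, real t)"
  using k
proof (induction k)
  case 0
  then show ?case using st x free by (simp add: orbit_0)
next
  case (Suc k)
  then have IH: "pigd_state G \<eta> M e1 x0 xi (Suc t + k) = (orbit x (xi t) k, real t)" by simp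
  have "real (Suc k) < M" using Suc.prems escape_steps(1) by (meson of_nat_le_iff order_le_less_trans)
  then have "\<not> (M \<le> real (Suc t + k) - real t)" by simp
  then show ?case using IH by (simp add: orbit_Suc Let_def)
qed

text \<open>A guaranteed average decrease per step: the first entry comes from a plain step with a
  large oracle value, the second from a decrease \<open>F\<close> over a window of at most
  \<open>2 * M\<close> steps.\<close>

definition rate :: real where
  "rate = min (\<eta> * (1 - a) * e1\<^sup>2 / 20) (F / (2 * M))"

lemma rate_pos: "0 < rate"
  using \<eta>_pos a e1 F_pos M_ge by (simp add: rate_def)

lemma large_gradient_step:
  assumes x: "e1 / 2 < norm (G x)"
  shows "g (x - \<eta> *\<^sub>R G x) \<le> g x - rate"
proof -
  define n where "n = norm (grad g x)"
  have "norm (G x) \<le> norm (grad g x) + norm (G x - grad g x)" by (rule norm_triangle_sub)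
  then have "31 / 64 * e1 \<le> (1 + a) * n"
    using x G_error[of x] b by (simp add: n_def algebra_simps)
  also have "\<dots> \<le> 21 / 20 * n" using a by (intro mult_right_mono) (auto simp: n_def)
  finally have "46 / 100 * e1 \<le> n" using e1 by simp
  then have "(46 / 100 * e1)\<^sup>2 \<le> n\<^sup>2" using e1 by (intro power_mono) auto
  then have 1: "\<eta> * (1 - a) / 4 * (46 / 100 * e1)\<^sup>2 \<le> \<eta> * (1 - a) / 4 * n\<^sup>2"
    using \<eta>_pos a by (intro mult_left_mono) auto
  have "b\<^sup>2 \<le> (e1 / 64)\<^sup>2" using b by (intro power_mono) auto
  then have 2: "5 * \<eta> * b\<^sup>2 \<le> 5 * \<eta> * (e1 / 64)\<^sup>2" using \<eta>_pos by (intro mult_left_mono) auto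
  have "\<eta> * e1\<^sup>2 * (95 / 100) \<le> \<eta> * e1\<^sup>2 * (1 - a)"
    using \<eta>_pos a by (intro mult_left_mono) auto
  \<comment> \<open>The slack between 529/10000 and 1/20, times \<open>1 - a\<close>, exceeds the
    loss 5/4096.\<close>
  then have 3: "5 * \<eta> * (e1 / 64)\<^sup>2 \<le> \<eta> * (1 - a) / 4 * (46 / 100 * e1)\<^sup>2 - \<eta> * (1 - a) * e1\<^sup>2 / 20"
    using \<eta>_pos e1 by (simp add: power_mult_distrib power_divide field_simps)
  have "g (x - \<eta> *\<^sub>R G x) \<le> g x - \<eta> * (1 - a) / 4 * n\<^sup>2 + 5 * \<eta> * b\<^sup>2"
    unfolding n_def by (rule step_decrease[OF G_error b(1)])
  also have "\<dots> \<le> g x - \<eta> * (1 - a) * e1\<^sup>2 / 20" using 1 2 3 by linarith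
  finally show ?thesis by (simp add: rate_def)
qed

text \<open>An invariant for the times between windows; inside a window \<open>g\<close> may rise
  for a while. Time 0 qualifies because \<open>t_pert\<close> starts at \<open>- M\<close>.\<close>

definition good_time :: "real^'n \<Rightarrow> (nat \<Rightarrow> real^'n) \<Rightarrow> nat \<Rightarrow> bool" where
  "good_time x0 xi s \<longleftrightarrow> M \<le> real s - snd (pigd_state G \<eta> M e1 x0 xi s) \<and>
     g (iterate x0 xi s) \<le> g x0 - rate * real s"

text \<open>If the oracle value is large, one plain step suffices; otherwise a perturbation starts,
  and as it does not fail, the end of its window is the next good time.\<close>

lemma next_good_time:
  assumes s: "good_time x0 xi s" and xi: "xi \<in> space (noise_space r)" "xi \<notin> bad_noise x0 s"
    and nc: "\<not> second_order_critical g e1 e2 (iterate x0 xi s)"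
  shows "\<exists>s'. s < s' \<and> s' \<le> s + Suc escape_steps \<and> good_time x0 xi s'"
proof -
  obtain x tp where st: "pigd_state G \<eta> M e1 x0 xi s = (x, tp)" by fastforce
  have x: "iterate x0 xi s = x" by (simp add: pigd_iter_def st)
  have free: "M \<le> real s - tp" and gx: "g x \<le> g x0 - rate * real s"
    using s by (auto simp: good_time_def st x)
  show ?thesis
  proof (cases "norm (G x) \<le> e1 / 2")
    case True
    have ps: "pigd_state G \<eta> M e1 x0 xi (s + Suc escape_steps) = (orbit x (xi s) escape_steps, real s)"
      using perturbed_state[OF st True free, of escape_steps] by simp
    have "\<not> stuck x (xi s)" using xi nc True by (auto simp: bad_noise_def x)
    then have "g (orbit x (xi s) escape_steps) \<le> g x - F" by (simp add: stuck_def)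
    moreover have "rate * (real escape_steps + 1) \<le> F"
    proof -
      have "rate * (real escape_steps + 1) \<le> F / (2 * M) * (2 * M)"
        using rate_pos escape_steps M_ge F_pos by (intro mult_mono) (auto simp: rate_def)
      then show ?thesis using M_ge by simp
    qed
    ultimately have "good_time x0 xi (s + Suc escape_steps)"
      using gx escape_steps unfolding good_time_def pigd_iter_def ps by (simp add: algebra_simps)
    then show ?thesis by (intro exI[of _ "s + Suc escape_steps"]) simp
  next
    case False
    then have "pigd_state G \<eta> M e1 x0 xi (Suc s) = (x - \<eta> *\<^sub>R G x, tp)" by (simp add: st)
    then have "good_time x0 xi (Suc s)"
      using large_gradient_step[of x] False free gx unfolding good_time_def pigd_iter_def
      by (simp add: algebra_simps)
    then show ?thesis by (intro exI[of _ "Suc s"]) simp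
  qed
qed

text \<open>The successor of the last good time up to \<open>T\<close> lies beyond \<open>T\<close>,
  so that last good time is at least \<open>T - M\<close>; a window cut off by \<open>T\<close> is
  the reason for the \<open>- M\<close>. There \<open>g\<close> would be below its infimum.\<close>

lemma critical_if_no_bad_noise:
  assumes xi: "xi \<in> space (noise_space r)" "\<And>t. t \<le> T \<Longrightarrow> xi \<notin> bad_noise x0 t"
    and T: "g x0 - Inf (range g) < rate * (real T - M)"
  shows "\<exists>t\<le>T. second_order_critical g e1 e2 (iterate x0 xi t)"
proof (rule ccontr)
  assume nc: "\<not> ?thesis"
  define s where "s = Max {s. s \<le> T \<and> good_time x0 xi s}"
  have fin: "finite {s. s \<le> T \<and> good_time x0 xi s}" by simp
  have "good_time x0 xi 0" by (simp add: good_time_def pigd_iter_def)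
  then have s: "s \<le> T" "good_time x0 xi s"
    using Max_in[OF fin] unfolding s_def by blast+
  obtain s' where s': "s < s'" "s' \<le> s + Suc escape_steps" "good_time x0 xi s'"
    using next_good_time[OF s(2) xi(1) xi(2)[OF s(1)]] nc s(1) by blast
  have "s' \<le> s" if "s' \<le> T" unfolding s_def using that s'(3) by (intro Max_ge[OF fin]) simp
  then have "\<not> s' \<le> T" using s'(1) by auto
  then have "T \<le> s + escape_steps" using s'(2) by simp
  then have "real T - M \<le> real s" using escape_steps(1) by linarith
  then have "rate * (real T - M) \<le> rate * real s" using rate_pos by (intro mult_left_mono) auto
  moreover have "Inf (range g) \<le> g (iterate x0 xi s)" by (rule cInf_lower[OF _ bdd]) simp
  ultimately show False using s(2) T by (simp add: good_time_def)
qed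

lemma success_probability:
  assumes T: "g x0 - Inf (range g) < rate * (real T - M)"
    and \<delta>: "(real T + 1) * (5 / 3 * sqrt (real CARD('n)) * gap / r) \<le> \<delta>"
  shows "1 - \<delta> \<le> measure (noise_space r)
     {xi \<in> space (noise_space r). \<exists>t\<le>T. second_order_critical g e1 e2 (iterate x0 xi t)}"
    (is "_ \<le> measure _ ?A")
proof -
  interpret P: prob_space "noise_space r :: (nat \<Rightarrow> real^'n) measure"
    unfolding noise_space_def by (intro prob_space_PiM prob_space_uniform_noise)
  have A: "?A \<in> sets (noise_space r)" by measurable
  have "space (noise_space r) - ?A \<subseteq> (\<Union>t\<in>{..T}. bad_noise x0 t)"
    using critical_if_no_bad_noise[OF _ _ T] by blast
  then have "measure (noise_space r) (space (noise_space r) - ?A)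
      \<le> measure (noise_space r) (\<Union>t\<in>{..T}. bad_noise x0 t)"
    using bad_noise_sets by (intro P.finite_measure_mono) auto
  also have "\<dots> \<le> (\<Sum>t\<in>{..T}. measure (noise_space r) (bad_noise x0 t))"
    using bad_noise_sets by (intro P.finite_measure_subadditive_finite) auto
  also have "\<dots> \<le> (\<Sum>t\<in>{..T}. 5 / 3 * sqrt (real CARD('n)) * gap / r)"
    by (intro sum_mono measure_bad_noise_le)
  also have "\<dots> \<le> \<delta>" using \<delta> by (simp add: add.commute)
  finally show ?thesis using P.prob_compl[OF A] by simp
qed

end

section \<open>The parameters\<close>

text \<open>Equivalent to \<open>l \<le> 2 powr (l / 5)\<close>. The power is bounded below by its
  tangent at 20, where it equals 16, with 2/3 in place of \<open>ln 2\<close>. It makes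
  \<open>\<gamma>\<close> comparable to \<open>log 2 \<phi>\<close>.\<close>

lemma log_le_fifth:
  assumes "24 \<le> l"
  shows "log 2 l \<le> l / 5"
proof -
  have "l \<le> 16 * (1 + (l - 20) / 5 * (2 / 3))" using assms by (simp add: field_simps)
  also have "\<dots> \<le> 16 * (1 + (l - 20) / 5 * ln 2)"
    using assms ln2_ge_two_thirds by (intro mult_left_mono add_left_mono) auto
  also have "\<dots> \<le> 16 * exp ((l - 20) / 5 * ln 2)"
    by (intro mult_left_mono exp_ge_add_one_self) auto
  also have "\<dots> = 2 powr real 4 * 2 powr ((l - 20) / 5)"
    by (subst powr_realpow) (simp_all add: powr_def)
  also have "\<dots> = 2 powr (real 4 + (l - 20) / 5)" by (simp only: powr_add)
  also have "real 4 + (l - 20) / 5 = l / 5" by (simp add: field_simps)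
  finally have "log 2 l \<le> log 2 (2 powr (l / 5))" using assms by (intro log_mono) auto
  then show ?thesis by simp
qed

theorem theorem1:
  fixes g :: "real^'n \<Rightarrow> real" and G :: "real^'n \<Rightarrow> real^'n" and x0 :: "real^'n"
    and L1 L2 \<alpha> \<beta> a b \<Delta>g \<delta> \<epsilon>1 \<epsilon>2 :: real
  defines "d \<equiv> CARD('n)"
  defines "\<phi> \<equiv> 2 ^ 24 * max 1 (5 * L2 * \<epsilon>1 / (L1 * \<epsilon>2)) * L1\<^sup>2 / \<delta> * sqrt (real d) *
              (\<Delta>g * max (L2\<^sup>2 / \<epsilon>2 ^ 5) (1 / (\<epsilon>1\<^sup>2 * \<epsilon>2)) + 1 / \<epsilon>2\<^sup>2)"
  defines "\<gamma> \<equiv> log 2 (\<phi> * (log 2 \<phi>) ^ 8)"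
  defines "F \<equiv> 1 / (800 * \<gamma> ^ 3) * (1 - a) / (1 + a)\<^sup>2 * \<epsilon>2 ^ 3 / L2\<^sup>2"
  defines "R \<equiv> 1 / (4 * \<gamma>) * \<epsilon>2 / L2"
  defines "\<eta> \<equiv> (1 - a) / (1 + a)\<^sup>2 * (1 / L1)"
  defines "r \<equiv> \<epsilon>2\<^sup>2 / (400 * L2 * \<gamma> ^ 3) * min 1 (L1 * \<epsilon>2 / (5 * \<epsilon>1 * L2))"
  defines "M \<equiv> (1 + a)\<^sup>2 / (1 - a) * L1 / \<epsilon>2 * \<gamma>"
  defines "T \<equiv> nat \<lceil>8 * \<Delta>g * max (2 * M / F) (256 / ((1 - a) * \<eta> * \<epsilon>1\<^sup>2)) + 4 * M\<rceil>"
  assumes L1_pos: "L1 > 0" and L2_pos: "L2 > 0" and \<alpha>_pos: "\<alpha> > 0" and \<beta>_pos: "\<beta> > 0"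
    and A1: "assumption_A1 g L1"
    and A2: "assumption_A2 g \<alpha> \<beta> L2"
    and a_nonneg: "0 \<le> a" and b_nonneg: "0 \<le> b"
    and G_oracle: "inexact_oracle g G a b"
    and G_meas: "G \<in> borel_measurable borel"
    and \<Delta>g: "\<Delta>g \<ge> g x0 - Inf (range g)"
    and \<delta>: "0 < \<delta>" "\<delta> < 1"
    and \<epsilon>1: "0 < \<epsilon>1" "\<epsilon>1 < \<alpha>"
    and \<epsilon>2: "0 < \<epsilon>2" "\<epsilon>2 < min (4 * \<gamma> * \<beta> * L2) (min L1 (L1\<^sup>2))"
    and a_small: "a \<le> min (1 / 20) (min (1 / (L1 * \<eta> * M * 2 powr (\<gamma> + 2)))
                          (R / (\<epsilon>1 * \<eta> * M * 2 powr (\<gamma> + 2))))"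
    and b_small: "b \<le> min (\<epsilon>1 / 64) (min (sqrt (F / (40 * \<eta> * M)))
                          (min (sqrt (L1 * F / (M * (5 * L1 + 1)))) (R / (M * \<eta> * 2 powr (\<gamma> + 2)))))"
  shows "measure (noise_space r)
           {xi \<in> space (noise_space r). \<exists>t\<le>T. second_order_critical g \<epsilon>1 \<epsilon>2 (pigd_iter G \<eta> M \<epsilon>1 x0 xi t)}
         \<ge> 1 - \<delta>"
proof -
  have a: "0 \<le> a" "a \<le> 1 / 20" using a_nonneg a_small by auto
  have one_le_mult: "1 \<le> x * y" if "1 \<le> x" "1 \<le> y" for x y :: real
    using mult_mono[of 1 x 1 y] that by simp
  define \<kappa> where "\<kappa> = (1 + a)\<^sup>2 / (1 - a)"
  have \<kappa>_pos: "0 < \<kappa>" using a by (simp add: \<kappa>_def)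
  have \<kappa>_inv: "(1 - a) / (1 + a)\<^sup>2 = 1 / \<kappa>" by (simp add: \<kappa>_def)
  have \<epsilon>2': "\<epsilon>2 < 4 * \<gamma> * \<beta> * L2" "\<epsilon>2 < L1" using \<epsilon>2 by auto
  have \<Delta>0: "0 \<le> \<Delta>g"
  proof -
    have "Inf (range g) \<le> g x0"
      using A1 by (intro cInf_lower) (auto simp: assumption_A1_def)
    then show ?thesis using \<Delta>g by simp
  qed
  define mm where "mm = max 1 (5 * L2 * \<epsilon>1 / (L1 * \<epsilon>2))"
  define mx where "mx = max (L2\<^sup>2 / \<epsilon>2 ^ 5) (1 / (\<epsilon>1\<^sup>2 * \<epsilon>2))"
  \<comment> \<open>The bracket in \<open>\<phi>\<close> with \<open>1 / \<epsilon>2\<^sup>2\<close>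
    factored out, so that \<open>W\<close> is at least 1.\<close>
  define W where "W = \<Delta>g * \<epsilon>2\<^sup>2 * mx + 1"
  define l where "l = log 2 \<phi>"
  have mm: "1 \<le> mm" by (simp add: mm_def)
  have mx: "0 < mx" using \<epsilon>1 \<epsilon>2 by (simp add: mx_def less_max_iff_disj)
  have W: "1 \<le> W" using \<Delta>0 mx by (simp add: W_def)
  have d: "1 \<le> sqrt (real d)" by (simp add: d_def Suc_leI)
  have \<phi>: "\<phi> = 2 ^ 24 * mm * (L1 / \<epsilon>2)\<^sup>2 / \<delta> * sqrt (real d) * W"
    unfolding \<phi>_def mm_def[symmetric] mx_def[symmetric] W_def using \<epsilon>2 \<delta>
    by (simp add: field_simps)
  have \<phi>_ge: "2 ^ 24 \<le> \<phi>"
  proof -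
    have "1 \<le> L1 / \<epsilon>2" using \<epsilon>2' \<epsilon>2 by simp
    then have "1 \<le> mm * (L1 / \<epsilon>2)\<^sup>2 * (1 / \<delta>) * sqrt (real d) * W"
      using mm W d \<delta> by (intro one_le_mult one_le_power) auto
    then show ?thesis unfolding \<phi> by simp
  qed
  have l: "24 \<le> l"
  proof -
    have "2 powr real 24 \<le> \<phi>" using \<phi>_ge by (subst powr_realpow) simp_all
    then show ?thesis using \<phi>_ge by (simp only: l_def) (subst le_log_iff, simp_all)
  qed
  have \<phi>_pos: "0 < \<phi>" using \<phi>_ge by simp
  have pow\<gamma>: "2 powr \<gamma> = \<phi> * l ^ 8"
    unfolding \<gamma>_def l_def[symmetric] using \<phi>_pos l by simp
  have \<gamma>_eq: "\<gamma> = l + 8 * log 2 l"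
    using \<phi>_pos l log_nat_power[of l 2 8] by (simp add: \<gamma>_def log_mult flip: l_def)
  have "0 \<le> log 2 l" using l by simp
  then have \<gamma>_ge: "24 \<le> \<gamma>" using \<gamma>_eq l by linarith
  have \<gamma>_le: "\<gamma> \<le> 13 / 5 * l" using \<gamma>_eq log_le_fifth[OF l] by linarith
  have \<eta>_eq: "\<eta> = 1 / (\<kappa> * L1)" unfolding \<eta>_def \<kappa>_inv by simp
  have M_eq: "M = \<kappa> * L1 * \<gamma> / \<epsilon>2" by (simp add: M_def \<kappa>_def)
  have F_eq: "F = \<epsilon>2 ^ 3 / (800 * \<gamma> ^ 3 * \<kappa> * L2\<^sup>2)"
    unfolding F_def \<kappa>_def using a by simp
  have R_eq: "R = \<epsilon>2 / (4 * \<gamma> * L2)" by (simp add: R_def)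
  \<comment> \<open>The minimum in \<open>r\<close> is the reciprocal of the maximum in
    \<open>\<phi>\<close>; the two cancel in the failure probability.\<close>
  have r_eq: "r = \<epsilon>2\<^sup>2 / (400 * L2 * \<gamma> ^ 3 * mm)"
  proof -
    have "min 1 (L1 * \<epsilon>2 / (5 * \<epsilon>1 * L2)) = 1 / mm"
      unfolding mm_def using L1_pos L2_pos \<epsilon>1 \<epsilon>2 by (auto simp: min_def max_def field_simps)
    then show ?thesis by (simp add: r_def)
  qed
  have pos: "0 < \<eta>" "0 < M" "0 < F" "0 < R" "0 < r" "0 < \<gamma>" "0 < mm"
    unfolding \<eta>_eq M_eq F_eq R_eq r_eq using \<kappa>_pos L1_pos L2_pos \<epsilon>2 \<gamma>_ge mm by auto
  interpret inexact_descent g G L1 L2 \<alpha> \<beta> a b \<epsilon>1 \<epsilon>2 \<gamma> \<kappa> \<eta> M R F r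
  proof
    show "\<kappa> * (1 - a) = (1 + a)\<^sup>2" using a by (simp add: \<kappa>_def)
    show "\<eta> * \<kappa> * L1 = 1" using \<kappa>_pos L1_pos by (simp add: \<eta>_eq)
    show "\<eta> * M * \<epsilon>2 = \<gamma>" using \<kappa>_pos L1_pos \<epsilon>2 by (simp add: \<eta>_eq M_eq)
    show "4 * \<gamma> * L2 * R = \<epsilon>2" using pos L2_pos by (simp add: R_eq)
    show "R \<le> \<beta>" unfolding R_eq using \<epsilon>2'(1) pos L2_pos by (simp add: divide_le_eq mult_ac)
    show "50 * \<kappa> * M * \<eta> * F = R\<^sup>2"
      unfolding M_eq \<eta>_eq F_eq R_eq using \<kappa>_pos L1_pos L2_pos \<epsilon>2 pos
      by (simp add: field_simps power2_eq_square power3_eq_cube)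
    have "b\<^sup>2 \<le> (sqrt (F / (40 * \<eta> * M)))\<^sup>2" using b_small b_nonneg by (intro power_mono) auto
    also have "\<dots> = F / (40 * \<eta> * M)" using pos by simp
    finally show "40 * \<eta> * M * b\<^sup>2 \<le> F" using pos by (simp add: field_simps)
    show "1000 * \<eta> * r\<^sup>2 \<le> F"
    proof -
      have "r \<le> \<epsilon>2\<^sup>2 / (400 * L2 * \<gamma> ^ 3)"
        unfolding r_eq using L2_pos pos mm by (intro divide_left_mono) auto
      then have "1000 * \<eta> * r\<^sup>2 \<le> 1000 * \<eta> * (\<epsilon>2\<^sup>2 / (400 * L2 * \<gamma> ^ 3))\<^sup>2"
        using pos by (intro mult_left_mono power_mono) auto
      also have "\<dots> = F * (5 * \<epsilon>2 / (L1 * \<gamma> ^ 3))"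
        unfolding \<eta>_eq F_eq using \<kappa>_pos L1_pos L2_pos pos
        by (simp add: field_simps power2_eq_square power3_eq_cube)
      also have "\<dots> \<le> F * 1"
      proof (intro mult_left_mono)
        have "1 \<le> \<gamma>\<^sup>2" using \<gamma>_ge by (intro one_le_power) auto
        then have "5 \<le> \<gamma> * \<gamma>\<^sup>2" using \<gamma>_ge mult_mono[of 5 \<gamma> 1 "\<gamma>\<^sup>2"] by auto
        then have "\<epsilon>2 * 5 \<le> L1 * \<gamma> ^ 3"
          using \<epsilon>2 \<epsilon>2' by (intro mult_mono) (auto simp: power3_eq_cube power2_eq_square)
        then show "5 * \<epsilon>2 / (L1 * \<gamma> ^ 3) \<le> 1" using L1_pos pos by (simp add: divide_le_eq mult.commute)
      qed (use pos in simp)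
      finally show ?thesis by simp
    qed
    show "a * (L1 * \<eta> * M * 2 powr (\<gamma> + 2)) \<le> 1"
      using a_small L1_pos pos by (simp add: pos_le_divide_eq)
    show "a * (\<epsilon>1 * \<eta> * M * 2 powr (\<gamma> + 2)) \<le> R"
      using a_small \<epsilon>1 pos by (simp add: pos_le_divide_eq)
    show "b * (M * \<eta> * 2 powr (\<gamma> + 2)) \<le> R"
      using b_small pos by (simp add: pos_le_divide_eq)
  qed (use A1 A2 G_oracle G_meas L1_pos L2_pos \<beta>_pos \<epsilon>1 \<epsilon>2 \<epsilon>2' a b_nonneg b_small \<gamma>_ge pos in auto)
  define K where "K = max (2 * M / F) (256 / ((1 - a) * \<eta> * \<epsilon>1\<^sup>2))"
  have K_pos: "0 < K" using pos by (simp add: K_def less_max_iff_disj)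
  have T_real: "0 \<le> 8 * \<Delta>g * K + 4 * M" using \<Delta>0 K_pos pos by simp
  have T_bounds: "8 * \<Delta>g * K + 4 * M \<le> real T" "real T \<le> 8 * \<Delta>g * K + 4 * M + 1"
    unfolding T_def K_def[symmetric] using T_real by linarith+
  show ?thesis
  proof (rule success_probability)
    \<comment> \<open>Each entry of the maximum \<open>K\<close> is at least the reciprocal of the
      matching entry of the minimum \<open>rate\<close>.\<close>
    have "1 \<le> rate * K"
    proof (cases "\<eta> * (1 - a) * \<epsilon>1\<^sup>2 / 20 \<le> F / (2 * M)")
      case True
      have "1 \<le> \<eta> * (1 - a) * \<epsilon>1\<^sup>2 / 20 * (256 / ((1 - a) * \<eta> * \<epsilon>1\<^sup>2))"
        using pos a \<epsilon>1 by simp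
      also have "\<dots> \<le> rate * K"
        using True rate_pos pos a by (intro mult_mono) (auto simp: rate_def K_def)
      finally show ?thesis .
    next
      case False
      have "1 \<le> F / (2 * M) * (2 * M / F)" using pos by simp
      also have "\<dots> \<le> rate * K"
        using False rate_pos pos by (intro mult_mono) (auto simp: rate_def K_def)
      finally show ?thesis .
    qed
    then have "8 * \<Delta>g * 1 \<le> 8 * \<Delta>g * (rate * K)" using \<Delta>0 by (intro mult_left_mono) auto
    \<comment> \<open>The summand \<open>3 * M\<close> left over from \<open>4 * M\<close> makes the
      inequality strict even if \<open>\<Delta>g\<close> is 0.\<close>
    moreover have "0 < rate * (3 * M)" using rate_pos pos by simp
    moreover have "rate * (8 * \<Delta>g * K + 3 * M) \<le> rate * (real T - M)"
      using T_bounds(1) rate_pos by (intro mult_left_mono) auto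
    ultimately show "g x0 - Inf (range g) < rate * (real T - M)"
      using \<Delta>g \<Delta>0 by (simp add: algebra_simps)
  next
    have \<gamma>3: "1 \<le> \<gamma> ^ 3" using \<gamma>_ge by (intro one_le_power) auto
    have \<kappa>\<gamma>: "1 \<le> \<kappa> * \<gamma> ^ 3" using \<gamma>3 \<kappa>_bounds by (intro one_le_mult)
    \<comment> \<open>Brings both entries of \<open>K\<close> to the form occurring in
      \<open>W\<close>, so that the number of steps cancels against \<open>\<phi>\<close>.\<close>
    have K_le: "K \<le> 1600 * (\<kappa> * \<gamma> ^ 3) * M * (\<epsilon>2\<^sup>2 * mx)"
      unfolding K_def
    proof (rule max.boundedI)
      have "2 * M / F = 1600 * (\<kappa> * \<gamma> ^ 3) * M * (\<epsilon>2\<^sup>2 * (L2\<^sup>2 / \<epsilon>2 ^ 5))"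
        unfolding F_eq using \<epsilon>2 L2_pos \<kappa>_pos pos by (simp add: field_simps eval_nat_numeral)
      also have "\<dots> \<le> 1600 * (\<kappa> * \<gamma> ^ 3) * M * (\<epsilon>2\<^sup>2 * mx)"
        using \<kappa>_pos pos by (intro mult_left_mono) (auto simp: mx_def)
      finally show "2 * M / F \<le> 1600 * (\<kappa> * \<gamma> ^ 3) * M * (\<epsilon>2\<^sup>2 * mx)" .
      have "256 / ((1 - a) * \<eta> * \<epsilon>1\<^sup>2) = 256 / ((1 - a) * \<gamma>) * M * (\<epsilon>2\<^sup>2 * (1 / (\<epsilon>1\<^sup>2 * \<epsilon>2)))"
        unfolding M_eq \<eta>_eq using \<epsilon>2 \<epsilon>1 L1_pos \<kappa>_pos pos a by (simp add: field_simps power2_eq_square)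
      also have "\<dots> \<le> (1600 * (\<kappa> * \<gamma> ^ 3)) * M * (\<epsilon>2\<^sup>2 * mx)"
      proof (intro mult_mono mult_left_mono)
        have "95 / 100 * 24 \<le> (1 - a) * \<gamma>" using a \<gamma>_ge by (intro mult_mono) auto
        then have "256 / ((1 - a) * \<gamma>) \<le> 256 / (95 / 100 * 24)" by (intro divide_left_mono) auto
        then show "256 / ((1 - a) * \<gamma>) \<le> 1600 * (\<kappa> * \<gamma> ^ 3)" using \<kappa>\<gamma> by simp
      qed (use \<kappa>_pos pos \<epsilon>1 \<epsilon>2 in \<open>auto simp: mx_def\<close>)
      finally show "256 / ((1 - a) * \<eta> * \<epsilon>1\<^sup>2) \<le> 1600 * (\<kappa> * \<gamma> ^ 3) * M * (\<epsilon>2\<^sup>2 * mx)" .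
    qed
    have "real T + 1 \<le> 8 * \<Delta>g * K + (4 * M + 2)" using T_bounds by simp
    also have "\<dots> \<le> 8 * \<Delta>g * (1600 * (\<kappa> * \<gamma> ^ 3) * M * (\<epsilon>2\<^sup>2 * mx)) + 12800 * (\<kappa> * \<gamma> ^ 3) * M"
    proof (intro add_mono mult_left_mono K_le)
      have "1 * M \<le> \<kappa> * \<gamma> ^ 3 * M" using \<kappa>\<gamma> pos by (intro mult_right_mono) auto
      then show "4 * M + 2 \<le> 12800 * (\<kappa> * \<gamma> ^ 3) * M" using M_ge by linarith
    qed (use \<Delta>0 in auto)
    also have "\<dots> = 12800 * \<kappa> * \<gamma> ^ 3 * M * W" by (simp add: W_def algebra_simps)
    finally have T1: "real T + 1 \<le> 12800 * \<kappa> * \<gamma> ^ 3 * M * W" .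
    have "gap = 5 * \<epsilon>2 * \<kappa> * L1 / (4 * \<gamma> * L2 * 2 powr \<gamma>)"
      using gap_def by (simp add: R_eq \<eta>_eq)
    then have "gap / r = 500 * \<kappa> * L1 * \<gamma>\<^sup>2 * mm / (\<epsilon>2 * 2 powr \<gamma>)"
      unfolding r_eq using \<epsilon>2 L1_pos L2_pos \<kappa>_pos pos
      by (simp add: field_simps power2_eq_square power3_eq_cube)
    then have "5 / 3 * sqrt (real d) * gap / r
        = 5 / 3 * sqrt (real d) * (500 * \<kappa> * L1 * \<gamma>\<^sup>2 * mm / (\<epsilon>2 * 2 powr \<gamma>))"
      by (metis times_divide_eq_right)
    \<comment> \<open>As \<open>2 powr \<gamma>\<close> is \<open>\<phi> * l ^ 8\<close>, the
      factors \<open>sqrt d\<close> and \<open>mm\<close> cancel, \<open>\<delta>\<close> moves to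
      the numerator, and \<open>W\<close> stays below to cancel the one in the bound for
      \<open>T\<close>.\<close>
    also have "\<dots> = 2500 / 3 * \<kappa> * \<gamma>\<^sup>2 * \<delta> * \<epsilon>2 / (2 ^ 24 * L1 * W * l ^ 8)"
      unfolding pow\<gamma> \<phi> using \<epsilon>2 L1_pos \<delta> W d l pos
      by (simp add: field_simps power2_eq_square)
    finally have p: "5 / 3 * sqrt (real CARD('n)) * gap / r
        = 2500 / 3 * \<kappa> * \<gamma>\<^sup>2 * \<delta> * \<epsilon>2 / (2 ^ 24 * L1 * W * l ^ 8)" by (simp only: d_def)
    have "(real T + 1) * (5 / 3 * sqrt (real CARD('n)) * gap / r)
        \<le> (12800 * \<kappa> * \<gamma> ^ 3 * M * W) * (2500 / 3 * \<kappa> * \<gamma>\<^sup>2 * \<delta> * \<epsilon>2 / (2 ^ 24 * L1 * W * l ^ 8))"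
      unfolding p using T1 \<kappa>_pos pos \<delta> \<epsilon>2 L1_pos W l by (intro mult_right_mono) auto
    also have "\<dots> = 12800 * 2500 / 3 / 2 ^ 24 * \<kappa> ^ 3 * (\<gamma> ^ 6 / l ^ 8) * \<delta>"
      unfolding M_eq using L1_pos \<epsilon>2 W l by (simp add: field_simps eval_nat_numeral)
    \<comment> \<open>The exponent 6 is 3 from the number of steps, 1 from \<open>M\<close> and 2
      from \<open>gap / r\<close>. The power \<open>l ^ 8\<close> built into \<open>\<gamma>\<close>
      absorbs it, and with \<open>24 \<le> l\<close> the constant is about 0.55.\<close>
    also have "\<dots> \<le> 12800 * 2500 / 3 / 2 ^ 24 * (117 / 100) ^ 3 * ((13 / 5) ^ 6 / 24\<^sup>2) * \<delta>"
    proof (intro mult_right_mono mult_mono mult_left_mono)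
      show "\<kappa> ^ 3 \<le> (117 / 100) ^ 3" using \<kappa>_bounds by (intro power_mono) auto
      have "\<gamma> ^ 6 / l ^ 8 \<le> (13 / 5 * l) ^ 6 / l ^ 8"
        using \<gamma>_le pos l by (intro divide_right_mono power_mono) auto
      also have "\<dots> = (13 / 5) ^ 6 / l\<^sup>2" using l by (simp add: power_mult_distrib field_simps flip: power_add)
      also have "\<dots> \<le> (13 / 5) ^ 6 / 24\<^sup>2" using l by (intro divide_left_mono power_mono) auto
      finally show "\<gamma> ^ 6 / l ^ 8 \<le> (13 / 5) ^ 6 / 24\<^sup>2" .
    qed (use \<kappa>_pos pos l \<delta> in auto)
    also have "\<dots> \<le> 1 * \<delta>" using \<delta> by (intro mult_right_mono) (auto simp: power_divide)
    finally show "(real T + 1) * (5 / 3 * sqrt (real CARD('n)) * gap / r) \<le> \<delta>" by simp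
  qed
qed

end
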